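(* Let $(p_{m,n})_{m,n\in\mathbb N_0}$ be non-negative integers satisfying the polygon growth assumption, with generating function $P(x,q)=\sum_{m,n}p_{m,n}x^mq^n$, and let $0<x_c\le 1$ be the radius of convergence of $P(x,1)$. Assume that $P$ has a scaling function $\mathcal F:(s_-,s_+)\to\mathbb R$ with critical exponents $\theta\in\mathbb R$ and $\phi>0$, that is, $$P^{(sing)}(x,q)\sim(1-q)^\theta\,\mathcal F\!\left(\frac{1-x/x_c}{(1-q)^\phi}\right)\qquad (x,q)\to(x_c,1)\ \text{in}\ D(s_-,s_+).\qquad(\ast)$$ (i) Assume that $(\ast)$ remains valid under arbitrary differentiation with respect to $q$, that $s_+=\infty$, that $\mathcal F$ has an asymptotic expansion $\mathcal F(s)\sim\sum_{k\ge0}(-1)^kf_ks^{-\gamma_k}$ as $s\to\infty$, and that the corresponding (termwise differentiated) asymptotic expansion holds for all derivatives of $\mathcal F$. Then: (a) $\gamma_k=\frac{k-\theta}{\phi}$ for all $k\in\mathbb N_0$; (b) for all $k\in\mathbb N_0$, $$\left(\frac1{k!}\left.\frac{\partial^k}{\partial q^k}P(x,q)\right|_{q=1}\right)^{(sing)}\sim\frac{f_k}{(1-x/x_c)^{\gamma_k}}\qquad(x\nearrow x_c).$$ (ii) Assume that $(\ast)$ remains valid under arbitrary differentiation with respect to $x$, that $s_-\le0<s_+$, that $\mathcal F$ has an asymptotic expansion $\mathcal F(s)\sim\sum_{k\ge0}(-1)^kh_ks^{\alpha_k}$ as $s\searrow0$, and that the corresponding (termwise differentiated) asymptotic expansion holds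 for all derivatives of $\mathcal F$. Then: (a) $\alpha_k=k$ for all $k\in\mathbb N_0$; (b) for all $k\in\mathbb N_0$, with $\beta_k=k\phi-\theta$, $$\left(\frac1{k!}\left.\frac{\partial^k}{\partial x^k}P(x,q)\right|_{x=x_c}\right)^{(sing)}\sim\frac{x_c^{-k}h_k}{(1-q)^{\beta_k}}\qquad(q\nearrow1).$$
   Context: Polygon growth assumption: $p_{m,n}\in\mathbb N_0$; there are constants $A,B>0$ such that $p_{m,n}=0$ if $n\le Am$ or if $n\ge Bm^2$; and the sequence $\left(\sum_np_{m,n}\right)_{m\in\mathbb N_0}$ has infinitely many positive elements and grows at most exponentially (it is bounded by $C\mu^m$ for some $C,\mu>0$). Domain: for $s_-,s_+\in[-\infty,+\infty]$ with $s_-<s_+$, $D(s_-,s_+)=\{(x,q)\in(0,\infty)\times(0,1): s_-<(1-x/x_c)/(1-q)^\phi<s_+\}$. The asymptotic equality $(\ast)$ means: there is a power series $P^{(reg)}(x,q)$ convergent for $|x|<x_1$, $|q|<q_1$, for some $x_1>x_c$, $q_1>1$, such that $P^{(sing)}:=P-P^{(reg)}$ is asymptotically equal to (ratio tending to 1) the right-hand side as $(x,q)\to(x_c,1)$ within $D(s_-,s_+)$ (with $P$ convergent at these points). "Remains valid under arbitrary differentiation w.r.t. $q$ (resp. $x$)" means that for every $j\in\mathbb N$ the $j$-th partial derivative in $q$ (resp. $x$) of $P^{(sing)}$ is asymptotically equal, in the same limit, to the $j$-th partial derivative of the right-hand side. For a power series $g(x)$ with radius of convergence $x_c$, $g^{(sing)}(x)\sim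 r(x)$ as $x\nearrow x_c$ means that there is a power series $g^{(reg)}$ with radius of convergence larger than $x_c$ such that $(g(x)-g^{(reg)}(x))/r(x)\to1$ as $x\to x_c$ from the left along the reals; analogously for power series in $q$ with radius of convergence $1$ as $q\nearrow1$. The derivatives of $P$ in $q$ evaluated at $q=1$ are understood coefficientwise as power series in $x$ (for each $m$ only finitely many $p_{m,n}$ are nonzero); they have radius of convergence $x_c$. The derivatives of $P$ in $x$ at $x=x_c$ are understood coefficientwise as power series in $q$ (for each $n$ only finitely many $p_{m,n}$ are nonzero); they have radius of convergence $1$. Asymptotic expansions are in the Poincaré sense, with nonzero coefficients $f_k$ (resp. $h_k$) and strictly increasing exponents $\gamma_k$ (resp. $\alpha_k$). *)

theory Defs
  imports "HOL-Analysis.Analysis" "HOL-Library.Landau_Symbols"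
begin

unbundle asymp_equiv_syntax

text \<open>The sum over \<open>n\<close> of \<open>p m n\<close>, written over the support of \<open>p m\<close>; the support is finite
  under the growth assumption below.\<close>

definition row_sum :: "(nat \<Rightarrow> nat \<Rightarrow> nat) \<Rightarrow> nat \<Rightarrow> nat" where
  "row_sum p m = (\<Sum>n | p m n \<noteq> 0. p m n)"

definition polygon_growth :: "(nat \<Rightarrow> nat \<Rightarrow> nat) \<Rightarrow> bool" where
  "polygon_growth p \<longleftrightarrow>
     (\<exists>A>0. \<exists>B>0. \<forall>m n. real n \<le> A * real m \<or> real n \<ge> B * real m ^ 2 \<longrightarrow> p m n = 0) \<and>
     infinite {m. row_sum p m > 0} \<and>
     (\<exists>C>0. \<exists>\<mu>>0. \<forall>m. real (row_sum p m) \<le> C * \<mu> ^ m)"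

definition gf_converges :: "(nat \<Rightarrow> nat \<Rightarrow> real) \<Rightarrow> real \<Rightarrow> real \<Rightarrow> bool" where
  "gf_converges c x q \<longleftrightarrow> (\<lambda>(m, n). c m n * x ^ m * q ^ n) summable_on UNIV"

definition gf :: "(nat \<Rightarrow> nat \<Rightarrow> real) \<Rightarrow> real \<Rightarrow> real \<Rightarrow> real" where
  "gf c x q = (\<Sum>\<^sub>\<infinity>(m, n). c m n * x ^ m * q ^ n)"

definition gf_sing :: "(nat \<Rightarrow> nat \<Rightarrow> nat) \<Rightarrow> (nat \<Rightarrow> nat \<Rightarrow> real) \<Rightarrow> real \<Rightarrow> real \<Rightarrow> real" where
  "gf_sing p c x q = gf (\<lambda>m n. real (p m n)) x q - gf c x q"

definition scaling_domain :: "real \<Rightarrow> real \<Rightarrow> ereal \<Rightarrow> ereal \<Rightarrow> (real \<times> real) set" where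
  "scaling_domain xc \<phi> s\<^sub>m s\<^sub>p =
     {(x, q). 0 < x \<and> 0 < q \<and> q < 1 \<and>
        s\<^sub>m < ereal ((1 - x / xc) / (1 - q) powr \<phi>) \<and>
        ereal ((1 - x / xc) / (1 - q) powr \<phi>) < s\<^sub>p}"

definition scaling_form ::
  "real \<Rightarrow> real \<Rightarrow> real \<Rightarrow> (real \<Rightarrow> real) \<Rightarrow> real \<Rightarrow> real \<Rightarrow> real" where
  "scaling_form xc \<theta> \<phi> \<F> x q = (1 - q) powr \<theta> * \<F> ((1 - x / xc) / (1 - q) powr \<phi>)"

text \<open>\<open>c\<close> holds the coefficients of the regular part. It is an explicit argument because the
  differentiated relations below refer to the same regular part. The function \<open>\<F>\<close> is total, but
  only its values strictly between \<open>s\<^sub>m\<close> and \<open>s\<^sub>p\<close> are used. The relation \<open>f \<sim>[F] g\<close> differs from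
  \<open>f / g\<close> tending to 1 only in that it allows points at which both sides vanish.\<close>

definition has_scaling_function ::
  "(nat \<Rightarrow> nat \<Rightarrow> nat) \<Rightarrow> (nat \<Rightarrow> nat \<Rightarrow> real) \<Rightarrow> real \<Rightarrow> real \<Rightarrow> real \<Rightarrow> ereal \<Rightarrow> ereal
     \<Rightarrow> (real \<Rightarrow> real) \<Rightarrow> bool" where
  "has_scaling_function p c xc \<theta> \<phi> s\<^sub>m s\<^sub>p \<F> \<longleftrightarrow>
     (\<exists>x1>xc. \<exists>q1>1. \<forall>x q. \<bar>x\<bar> < x1 \<and> \<bar>q\<bar> < q1 \<longrightarrow> gf_converges c x q) \<and>
     (\<forall>\<^sub>F (x, q) in at (xc, 1) within scaling_domain xc \<phi> s\<^sub>m s\<^sub>p.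
        gf_converges (\<lambda>m n. real (p m n)) x q) \<and>
     (\<lambda>(x, q). gf_sing p c x q)
        \<sim>[at (xc, 1) within scaling_domain xc \<phi> s\<^sub>m s\<^sub>p]
     (\<lambda>(x, q). scaling_form xc \<theta> \<phi> \<F> x q)"

definition scaling_valid_q_derivs ::
  "(nat \<Rightarrow> nat \<Rightarrow> nat) \<Rightarrow> (nat \<Rightarrow> nat \<Rightarrow> real) \<Rightarrow> real \<Rightarrow> real \<Rightarrow> real \<Rightarrow> ereal \<Rightarrow> ereal
     \<Rightarrow> (real \<Rightarrow> real) \<Rightarrow> bool" where
  "scaling_valid_q_derivs p c xc \<theta> \<phi> s\<^sub>m s\<^sub>p \<F> \<longleftrightarrow>
     (\<forall>j. (\<lambda>(x, q). (deriv ^^ j) (\<lambda>q. gf_sing p c x q) q)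
             \<sim>[at (xc, 1) within scaling_domain xc \<phi> s\<^sub>m s\<^sub>p]
          (\<lambda>(x, q). (deriv ^^ j) (\<lambda>q. scaling_form xc \<theta> \<phi> \<F> x q) q))"

definition scaling_valid_x_derivs ::
  "(nat \<Rightarrow> nat \<Rightarrow> nat) \<Rightarrow> (nat \<Rightarrow> nat \<Rightarrow> real) \<Rightarrow> real \<Rightarrow> real \<Rightarrow> real \<Rightarrow> ereal \<Rightarrow> ereal
     \<Rightarrow> (real \<Rightarrow> real) \<Rightarrow> bool" where
  "scaling_valid_x_derivs p c xc \<theta> \<phi> s\<^sub>m s\<^sub>p \<F> \<longleftrightarrow>
     (\<forall>j. (\<lambda>(x, q). (deriv ^^ j) (\<lambda>x. gf_sing p c x q) x)
             \<sim>[at (xc, 1) within scaling_domain xc \<phi> s\<^sub>m s\<^sub>p]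
          (\<lambda>(x, q). (deriv ^^ j) (\<lambda>x. scaling_form xc \<theta> \<phi> \<F> x q) x))"

text \<open>\<open>deriv\<close> is a total operator, so the existence of the derivatives has to be required
  separately.\<close>

definition smooth_between :: "ereal \<Rightarrow> ereal \<Rightarrow> (real \<Rightarrow> real) \<Rightarrow> bool" where
  "smooth_between s\<^sub>m s\<^sub>p \<F> \<longleftrightarrow>
     (\<forall>j s. s\<^sub>m < ereal s \<and> ereal s < s\<^sub>p \<longrightarrow> (deriv ^^ j) \<F> differentiable at s)"

text \<open>Poincare expansion of \<open>\<F>\<close> in the powers \<open>s powr e k\<close> with coefficients \<open>a k\<close>, together with
  all termwise differentiated expansions (\<open>j = 0\<close> is the expansion of \<open>\<F>\<close> itself). The gauge
  functions of the \<open>j\<close>-th derivative are \<open>s powr (e k - j)\<close>, also for those finitely many \<open>k\<close>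
  whose differentiated term is identically zero.\<close>

definition asymp_expansion_with_derivs ::
  "real filter \<Rightarrow> (real \<Rightarrow> real) \<Rightarrow> (nat \<Rightarrow> real) \<Rightarrow> (nat \<Rightarrow> real) \<Rightarrow> bool" where
  "asymp_expansion_with_derivs G \<F> a e \<longleftrightarrow>
     (\<forall>j N. (\<lambda>s. (deriv ^^ j) \<F> s - (\<Sum>k\<le>N. (deriv ^^ j) (\<lambda>t. a k * t powr e k) s))
              \<in> o[G](\<lambda>s. s powr (e N - real j)))"

definition sing_asymp_equiv :: "(nat \<Rightarrow> real) \<Rightarrow> real \<Rightarrow> (real \<Rightarrow> real) \<Rightarrow> bool" where
  "sing_asymp_equiv a \<rho> r \<longleftrightarrow>
     conv_radius a = ereal \<rho> \<and>
     (\<exists>b. conv_radius b > ereal \<rho> \<and>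
          (\<lambda>x. (\<Sum>n. a n * x ^ n) - (\<Sum>n. b n * x ^ n)) \<sim>[at_left \<rho>] r)"

text \<open>Coefficients of the \<open>k\<close>-th derivative of the generating function in one variable, divided
  by \<open>fact k\<close>: of \<open>x ^ m\<close> for the \<open>q\<close>-derivative at \<open>q = 1\<close>, and of \<open>q ^ n\<close> for the
  \<open>x\<close>-derivative at \<open>x = xc\<close>. The sums are finite under the growth assumption.\<close>

definition q_deriv_coeff :: "(nat \<Rightarrow> nat \<Rightarrow> nat) \<Rightarrow> nat \<Rightarrow> nat \<Rightarrow> real" where
  "q_deriv_coeff p k m =
     (deriv ^^ k) (\<lambda>q. \<Sum>n | p m n \<noteq> 0. real (p m n) * q ^ n) 1 / fact k"

definition x_deriv_coeff :: "(nat \<Rightarrow> nat \<Rightarrow> nat) \<Rightarrow> real \<Rightarrow> nat \<Rightarrow> nat \<Rightarrow> real" where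
  "x_deriv_coeff p xc k n =
     (deriv ^^ k) (\<lambda>x. \<Sum>m | p m n \<noteq> 0. real (p m n) * x ^ m) xc / fact k"

end

theory Submission
  imports Defs "HOL-Complex_Analysis.Conformal_Mappings"
begin

text \<open>
  In case (i), fix \<open>x < xc\<close> close to \<open>xc\<close> and let \<open>q\<close> tend to 1 from the left, so that the
  scaling variable tends to infinity. The \<open>k\<close>-th \<open>q\<close>-derivative of \<open>P - P_reg\<close> converges, by Abel's
  theorem, to a difference \<open>L x\<close> of two power series, whereas that of the scaling form behaves like
  \<open>M x * (1 - q) powr (\<theta> + \<phi> * \<gamma> k - k)\<close> with \<open>M x \<noteq> 0\<close>, provided that
  \<open>\<theta> + \<phi> * \<gamma> l = l\<close> for all \<open>l < k\<close> (then the terms of lower order are annihilated by the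
  \<open>k\<close>-fold differentiation). The ratio of the two stays close to 1. A negative
  exponent is therefore impossible, and a positive one forces \<open>L\<close> to vanish near \<open>xc\<close>, which the
  identity theorem excludes because the two power series in \<open>L\<close> have different radii of convergence.
  So the exponent is zero and \<open>L\<close> is asymptotically equal to \<open>M\<close>. Case (ii) is the same argument with
  the variables exchanged, where now the scaling variable tends to 0.
\<close>

section \<open>Power series\<close>

text \<open>\<open>diffs\<close> gives the coefficients of the termwise derivative, so this is the
  induction step showing that \<open>k\<close> differentiations produce falling factorial
  coefficients.\<close>

lemma diffs_shift_fact:
  fixes a :: "nat \<Rightarrow> real"
  shows "diffs (\<lambda>n. fact (n + k) / fact n * a (n + k)) = (\<lambda>n. fact (n + Suc k) / fact n * a (n + Suc k))"
proof
  fix n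
  have "fact (n + Suc k) / fact n = real (Suc n) * (fact (Suc n + k) / fact (Suc n))"
    by (simp only: add_Suc_right add_Suc fact_Suc) (simp del: of_nat_Suc)
  then show "diffs (\<lambda>n. fact (n + k) / fact n * a (n + k)) n = fact (n + Suc k) / fact n * a (n + Suc k)"
    unfolding diffs_def by simp
qed

text \<open>Shifting the index by \<open>k\<close> loses nothing, because the binomial coefficient
  kills the terms with \<open>n < k\<close>. For the same reason the truncated exponent
  \<open>n - k\<close> is harmless.\<close>

lemma suminf_shift_fact_eq:
  fixes a :: "nat \<Rightarrow> real"
  assumes "summable (\<lambda>n. fact (n + k) / fact n * a (n + k) * x ^ n)"
  shows "summable (\<lambda>n. real (n choose k) * a n * x ^ (n - k))"
    and "(\<Sum>n. fact (n + k) / fact n * a (n + k) * x ^ n) = fact k * (\<Sum>n. real (n choose k) * a n * x ^ (n - k))"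
proof -
  let ?g = "\<lambda>n. real (n choose k) * a n * x ^ (n - k)"
  have eq: "fact (n + k) / fact n * a (n + k) * x ^ n = fact k * ?g (n + k)" for n
    by (simp add: binomial_fact field_simps)
  have "summable (\<lambda>n. fact k * ?g (n + k))"
    using assms unfolding eq .
  then have s: "summable (\<lambda>n. ?g (n + k))"
    using summable_cmult_iff[of "fact k :: real" "\<lambda>n. ?g (n + k)"] by simp
  then show g: "summable ?g"
    using summable_iff_shift[of ?g k] by simp
  have "suminf ?g = (\<Sum>n. ?g (n + k)) + sum ?g {..<k}"
    using suminf_split_initial_segment[OF g, of k] .
  also have "sum ?g {..<k} = 0"
    by (intro sum.neutral) (auto simp: binomial_eq_0)
  finally show "(\<Sum>n. fact (n + k) / fact n * a (n + k) * x ^ n) = fact k * suminf ?g"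
    unfolding eq using suminf_mult[OF s, of "fact k"] by simp
qed

text \<open>Agreement of \<open>f\<close> with the series on an open set is preserved by
  \<open>deriv\<close>, so the formula propagates from one derivative to the next by
  induction.\<close>

lemma iterated_deriv_powser:
  fixes a :: "nat \<Rightarrow> real"
  assumes sm: "\<And>x. \<bar>x\<bar> < R \<Longrightarrow> summable (\<lambda>n. a n * x ^ n)"
    and S: "open S" "\<And>x. x \<in> S \<Longrightarrow> \<bar>x\<bar> < R"
    and f: "\<And>x. x \<in> S \<Longrightarrow> f x = (\<Sum>n. a n * x ^ n)"
    and x: "x \<in> S"
  shows "summable (\<lambda>n. real (n choose k) * a n * x ^ (n - k))"
    and "(deriv ^^ k) f x = fact k * (\<Sum>n. real (n choose k) * a n * x ^ (n - k))"
proof -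
  let ?b = "\<lambda>k n. fact (n + k) / fact n * a (n + k)"
  have sm': "\<bar>x\<bar> < R \<Longrightarrow> summable (\<lambda>n. ?b k n * x ^ n)" for x k
  proof (induction k arbitrary: x)
    case 0
    then show ?case using sm by simp
  next
    case (Suc k)
    then show ?case
      using termdiff_converges[of x R "?b k"] unfolding diffs_shift_fact by simp
  qed
  have main: "x \<in> S \<Longrightarrow> (deriv ^^ k) f x = (\<Sum>n. ?b k n * x ^ n)" for x k
  proof (induction k arbitrary: x)
    case 0
    then show ?case using f by simp
  next
    case (Suc k)
    have "((\<lambda>z. \<Sum>n. ?b k n * z ^ n) has_field_derivative (\<Sum>n. ?b (Suc k) n * x ^ n)) (at x)"
      using termdiffs_strong'[of R "?b k" x] sm' S(2)[OF Suc.prems] unfolding diffs_shift_fact by simp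
    then have "((deriv ^^ k) f has_field_derivative (\<Sum>n. ?b (Suc k) n * x ^ n)) (at x)"
      by (rule has_field_derivative_transform_within_open[OF _ S(1) Suc.prems]) (simp add: Suc.IH)
    then show ?case
      by (simp add: DERIV_imp_deriv)
  qed
  note s = sm'[OF S(2)[OF x], of k]
  show "summable (\<lambda>n. real (n choose k) * a n * x ^ (n - k))"
    using suminf_shift_fact_eq(1)[OF s] .
  show "(deriv ^^ k) f x = fact k * (\<Sum>n. real (n choose k) * a n * x ^ (n - k))"
    using suminf_shift_fact_eq(2)[OF s] main[OF x] by simp
qed

text \<open>An easy form of Abel's theorem: absolute convergence at the end point \<open>r\<close>
  dominates the differentiated series on all of \<open>{0..r}\<close>, so the Weierstrass M-test
  makes its sum continuous up to \<open>r\<close>.\<close>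

lemma tendsto_iterated_deriv_powser_at_left:
  fixes a :: "nat \<Rightarrow> real"
  assumes r: "0 < r"
    and sm0: "summable (\<lambda>n. \<bar>a n\<bar> * r ^ n)"
    and smk: "summable (\<lambda>n. real (n choose k) * \<bar>a n\<bar> * r ^ (n - k))"
    and f: "\<And>x. 0 < x \<Longrightarrow> x < r \<Longrightarrow> f x = (\<Sum>n. a n * x ^ n)"
  shows "((deriv ^^ k) f \<longlongrightarrow> fact k * (\<Sum>n. real (n choose k) * a n * r ^ (n - k))) (at_left r)"
proof -
  let ?g = "\<lambda>x. \<Sum>n. real (n choose k) * a n * x ^ (n - k)"
  have sm: "summable (\<lambda>n. a n * x ^ n)" if "\<bar>x\<bar> < r" for x
  proof (rule summable_comparison_test'[OF sm0, of 0])
    show "norm (a n * x ^ n) \<le> \<bar>a n\<bar> * r ^ n" for n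
      using that by (auto simp: abs_mult power_abs intro!: mult_left_mono power_mono)
  qed
  have "continuous_on {0..r} ?g"
  proof (rule uniform_limit_theorem)
    show "uniform_limit {0..r} (\<lambda>n x. \<Sum>i<n. real (i choose k) * a i * x ^ (i - k)) ?g sequentially"
    proof (rule Weierstrass_m_test[OF _ smk])
      show "norm (real (n choose k) * a n * x ^ (n - k)) \<le> real (n choose k) * \<bar>a n\<bar> * r ^ (n - k)"
        if "x \<in> {0..r}" for n x
        using that by (auto simp: abs_mult power_abs intro!: mult_left_mono power_mono)
    qed
  qed (auto intro!: always_eventually continuous_intros)
  then have "(?g \<longlongrightarrow> ?g r) (at r within {0..r})"
    using r by (auto simp: continuous_on_def)
  then have "(?g \<longlongrightarrow> ?g r) (at_left r)"
    using r by (simp add: at_within_Icc_at_left)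
  then have "((\<lambda>x. fact k * ?g x) \<longlongrightarrow> fact k * ?g r) (at_left r)"
    by (intro tendsto_intros)
  moreover have "eventually (\<lambda>x. fact k * ?g x = (deriv ^^ k) f x) (at_left r)"
    using eventually_at_left_real[OF r]
  proof eventually_elim
    case (elim x)
    show ?case
      using iterated_deriv_powser(2)[of r a "{0<..<r}" f x k] sm f elim by auto
  qed
  ultimately show ?thesis
    by (rule Lim_transform_eventually)
qed

text \<open>Equality just left of \<rho> would spread to the whole complex disc by the identity
  theorem and force equal coefficients, hence equal radii of convergence.\<close>

lemma powser_not_eventually_eq:
  fixes a b :: "nat \<Rightarrow> real"
  assumes \<rho>: "0 < \<rho>" and a: "conv_radius a = ereal \<rho>" and b: "conv_radius b > ereal \<rho>"
  shows "\<not> eventually (\<lambda>x. (\<Sum>n. a n * x ^ n) = (\<Sum>n. b n * x ^ n)) (at_left \<rho>)"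
proof
  assume ev: "eventually (\<lambda>x. (\<Sum>n. a n * x ^ n) = (\<Sum>n. b n * x ^ n)) (at_left \<rho>)"
  define d where "d n = complex_of_real (a n - b n)" for n
  let ?f = "\<lambda>z. \<Sum>n. d n * z ^ n"
  have sa: "summable (\<lambda>n. \<bar>a n\<bar> * x ^ n)" "summable (\<lambda>n. \<bar>b n\<bar> * x ^ n)" if "0 \<le> x" "x < \<rho>" for x
  proof -
    have "ereal (norm x) < conv_radius a" "ereal (norm x) < conv_radius b"
      using that a order.strict_trans[OF _ b, of "ereal x"] by auto
    then show "summable (\<lambda>n. \<bar>a n\<bar> * x ^ n)" "summable (\<lambda>n. \<bar>b n\<bar> * x ^ n)"
      using abs_summable_in_conv_radius[of x a] abs_summable_in_conv_radius[of x b] that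
      by (auto simp: abs_mult)
  qed
  have sd: "summable (\<lambda>n. d n * z ^ n)" if "z \<in> ball 0 \<rho>" for z
  proof (rule summable_comparison_test'[of "\<lambda>n. \<bar>a n\<bar> * norm z ^ n + \<bar>b n\<bar> * norm z ^ n" 0])
    show "summable (\<lambda>n. \<bar>a n\<bar> * norm z ^ n + \<bar>b n\<bar> * norm z ^ n)"
      using that by (intro summable_add sa) auto
    show "norm (d n * z ^ n) \<le> \<bar>a n\<bar> * norm z ^ n + \<bar>b n\<bar> * norm z ^ n" for n
      using mult_right_mono[of "\<bar>a n - b n\<bar>" "\<bar>a n\<bar> + \<bar>b n\<bar>" "norm z ^ n"]
      by (simp add: d_def norm_mult norm_power distrib_right del: of_real_diff)
  qed
  have sums: "(\<lambda>n. d n * (z - 0) ^ n) sums ?f z" if "z \<in> ball 0 \<rho>" for z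
    using summable_sums[OF sd[OF that]] by simp
  have hol: "?f holomorphic_on ball 0 \<rho>"
    by (rule power_series_holomorphic[OF sums])
  obtain l where l: "l < \<rho>" "\<And>x. l < x \<Longrightarrow> x < \<rho> \<Longrightarrow> (\<Sum>n. a n * x ^ n) = (\<Sum>n. b n * x ^ n)"
    using ev unfolding eventually_at_left_field by blast
  define m where "m = max l 0"
  have m: "0 \<le> m" "m < \<rho>" "l \<le> m" using l \<rho> by (auto simp: m_def)
  define U where "U = complex_of_real ` {m<..<\<rho>}"
  \<comment> \<open>The identity theorem needs a limit point of zeros inside the disc. The point
    \<rho> itself lies on the boundary, so the midpoint of the segment is taken.\<close>
  define \<xi> where "\<xi> = (m + \<rho>) / 2"
  have \<xi>: "m < \<xi>" "\<xi> < \<rho>" using m by (auto simp: \<xi>_def)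
  have "\<xi> islimpt {m<..<\<rho>}"
    using \<xi> by (intro interior_limit_point) (auto simp: interior_open)
  then have lim: "complex_of_real \<xi> islimpt U"
    unfolding U_def islimpt_approachable bex_simps(7) dist_of_real of_real_eq_iff by blast
  have zero: "?f z = 0" if zU: "z \<in> U" for z
  proof -
    obtain x where x: "z = of_real x" "m < x" "x < \<rho>" using zU by (auto simp: U_def)
    have s: "summable (\<lambda>n. a n * x ^ n)" "summable (\<lambda>n. b n * x ^ n)"
      using sa[of x] x m summable_rabs_cancel[of "\<lambda>n. a n * x ^ n"] summable_rabs_cancel[of "\<lambda>n. b n * x ^ n"]
      by (simp_all add: abs_mult power_abs)
    have "(\<lambda>n. a n * x ^ n - b n * x ^ n) sums 0"
      using sums_diff[OF s[THEN summable_sums]] l x m by simp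
    then have "(\<lambda>n. complex_of_real (a n * x ^ n - b n * x ^ n)) sums of_real 0"
      by (rule sums_of_real)
    then show ?thesis
      by (intro sums_unique[symmetric]) (simp add: d_def x algebra_simps)
  qed
  have f0: "?f w = 0" if "w \<in> ball 0 \<rho>" for w
    by (rule analytic_continuation[OF hol _ _ _ _ lim zero that])
       (use \<xi> m in \<open>auto simp: U_def\<close>)
  have "d n = 0" for n
  proof (rule ccontr)
    assume dn: "d n \<noteq> 0"
    \<comment> \<open>The result on isolated zeros used next needs a nonzero coefficient of positive
      index; the value at the origin rules out index 0.\<close>
    have "d 0 = 0"
      using f0[of 0] \<rho> by simp
    then have "n > 0" using dn by (cases n) auto
    obtain s where s: "0 < s" "\<And>z. z \<in> cball 0 s - {0} \<Longrightarrow> ?f z \<noteq> 0"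
    proof (rule powser_0_nonzero[OF \<rho>, of 0 d ?f n])
      show "(\<lambda>n. d n * (z - 0) ^ n) sums ?f z" if "norm (z - 0) < \<rho>" for z
        using that by (intro sums) (simp add: dist_norm)
    qed (use f0[of 0] \<rho> dn \<open>n > 0\<close> in simp_all)
    have "complex_of_real (min s (\<rho> / 2)) \<in> cball 0 s - {0}" "complex_of_real (min s (\<rho> / 2)) \<in> ball 0 \<rho>"
      using s \<rho> by (auto simp: min_def)
    then show False using s(2) f0 by blast
  qed
  then have "a = b" by (auto simp: d_def)
  then show False using a b by simp
qed

section \<open>Iterated limits of asymptotically equal functions\<close>

text \<open>For fixed \<open>u\<close>, \<open>g u v\<close> behaves like
  \<open>M u * \<tau> v powr d\<close> while \<open>f u v\<close> has the finite limit
  \<open>L u\<close>. Since the relative error of \<open>f\<close> against \<open>g\<close> is small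
  in the nested sense, both signs of \<open>d\<close> are contradictory, and for
  \<open>d = 0\<close> the error bound itself passes to the inner limit.\<close>

lemma exponent_zero_and_asymp_equiv:
  fixes f g :: "'u \<Rightarrow> 'v \<Rightarrow> real"
  assumes close: "\<And>\<epsilon>. \<epsilon> > 0 \<Longrightarrow> \<forall>\<^sub>F u in G. \<forall>\<^sub>F v in H. \<bar>f u v - g u v\<bar> \<le> \<epsilon> * \<bar>g u v\<bar>"
    and f: "\<forall>\<^sub>F u in G. (f u \<longlongrightarrow> L u) H"
    and g: "\<forall>\<^sub>F u in G. ((\<lambda>v. g u v / \<tau> v powr d) \<longlongrightarrow> M u) H"
    and M: "\<forall>\<^sub>F u in G. M u \<noteq> 0"
    and \<tau>: "filterlim \<tau> (at_right 0) H"
    and nontriv: "G \<noteq> bot" "H \<noteq> bot"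
    and L: "\<not> (\<forall>\<^sub>F u in G. L u = 0)"
  shows "d = 0" and "L \<sim>[G] M"
proof -
  have \<tau>0: "(\<tau> \<longlongrightarrow> 0) H" and \<tau>pos: "\<forall>\<^sub>F v in H. \<tau> v > 0"
    using \<tau> by (simp_all add: filterlim_at eventually_conj_iff)
  have geq: "\<forall>\<^sub>F v in H. g u v / \<tau> v powr e * \<tau> v powr e = g u v" for u e
    using \<tau>pos by eventually_elim simp
  have \<tau>nn: "\<forall>\<^sub>F v in H. \<tau> v \<ge> 0"
    using \<tau>pos by eventually_elim simp
  have "\<not> d > 0"
  proof
    assume "d > 0"
    then have \<tau>d: "((\<lambda>v. \<tau> v powr d) \<longlongrightarrow> 0) H"
      by (intro tendsto_zero_powrI[OF \<tau>0 tendsto_const \<tau>nn])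
    \<comment> \<open>Relative error at most 1 already suffices here: \<open>g u\<close> tends to 0
      and drags \<open>f u\<close> along.\<close>
    have "\<forall>\<^sub>F u in G. L u = 0"
      using f g close[OF zero_less_one]
    proof eventually_elim
      case (elim u)
      have "((\<lambda>v. g u v / \<tau> v powr d * \<tau> v powr d) \<longlongrightarrow> 0) H"
        using tendsto_mult[OF elim(2) \<tau>d] by simp
      then have g0: "(g u \<longlongrightarrow> 0) H"
        by (rule Lim_transform_eventually) (rule geq)
      have "((\<lambda>v. f u v - g u v) \<longlongrightarrow> 0) H"
      proof (rule Lim_null_comparison)
        show "\<forall>\<^sub>F v in H. norm (f u v - g u v) \<le> \<bar>g u v\<bar>"
          using elim(3) by simp
      qed (use tendsto_rabs[OF g0] in simp)
      from tendsto_add[OF this g0] have "(f u \<longlongrightarrow> 0) H" by simp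
      then show "L u = 0"
        using elim(1) nontriv(2) tendsto_unique by blast
    qed
    then show False using L by simp
  qed
  moreover have "\<not> d < 0"
  proof
    assume "d < 0"
    then have \<tau>d: "((\<lambda>v. \<tau> v powr (- d)) \<longlongrightarrow> 0) H"
      by (intro tendsto_zero_powrI[OF \<tau>0 tendsto_const \<tau>nn]) simp
    \<comment> \<open>With relative error 1/2, \<open>f\<close> is at least half of \<open>g\<close>
      in absolute value. After scaling by \<open>\<tau> v powr (- d)\<close> the bounded
      \<open>f\<close> contributes 0 in the limit, whereas \<open>g\<close> contributes
      \<open>M u\<close>.\<close>
    have half: "(1 / 2 :: real) > 0" by simp
    have "\<forall>\<^sub>F u in G. False"
      using f g M close[OF half]
    proof eventually_elim
      case (elim u)
      have "((\<lambda>v. \<bar>f u v\<bar> * \<tau> v powr (- d)) \<longlongrightarrow> 0) H"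
        using tendsto_mult[OF tendsto_rabs[OF elim(1)] \<tau>d] by simp
      moreover have "((\<lambda>v. 1 / 2 * \<bar>g u v / \<tau> v powr d\<bar>) \<longlongrightarrow> 1 / 2 * \<bar>M u\<bar>) H"
        using elim(2) by (intro tendsto_intros)
      moreover have "\<forall>\<^sub>F v in H. 1 / 2 * \<bar>g u v / \<tau> v powr d\<bar> \<le> \<bar>f u v\<bar> * \<tau> v powr (- d)"
        using elim(4) \<tau>pos
      proof eventually_elim
        case (elim v)
        then have "\<bar>g u v\<bar> / 2 \<le> \<bar>f u v\<bar>" by linarith
        then have "\<bar>g u v\<bar> / 2 * inverse (\<tau> v powr d) \<le> \<bar>f u v\<bar> * inverse (\<tau> v powr d)"
          by (rule mult_right_mono) simp
        then show ?case
          by (simp add: abs_divide powr_minus divide_simps)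
      qed
      ultimately have "1 / 2 * \<bar>M u\<bar> \<le> 0"
        using nontriv(2) by (rule tendsto_le[rotated])
      then show False using elim(3) by simp
    qed
    then show False using nontriv(1) by simp
  qed
  ultimately show d: "d = 0" by simp
  have "(\<lambda>u. L u - M u) \<in> o[G](M)"
  proof (rule landau_o.smallI)
    fix \<epsilon> :: real assume "\<epsilon> > 0"
    from close[OF this] show "\<forall>\<^sub>F u in G. norm (L u - M u) \<le> \<epsilon> * norm (M u)"
      using f g
    proof eventually_elim
      case (elim u)
      have gM: "(g u \<longlongrightarrow> M u) H"
        using Lim_transform_eventually[OF elim(3)] \<tau>pos d by (simp add: eventually_mono)
      have lim: "((\<lambda>v. \<bar>f u v - g u v\<bar>) \<longlongrightarrow> \<bar>L u - M u\<bar>) H" "((\<lambda>v. \<epsilon> * \<bar>g u v\<bar>) \<longlongrightarrow> \<epsilon> * \<bar>M u\<bar>) H"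
        by (intro tendsto_rabs tendsto_diff tendsto_mult_left elim(2) gM)+
      then show ?case
        using tendsto_le[OF nontriv(2) lim(2,1) elim(1)] by simp
    qed
  qed
  then show "L \<sim>[G] M"
    by (simp add: asymp_equiv_altdef)
qed

lemma asymp_equiv_imp_eventually_close:
  assumes "f \<sim>[F] g" "\<epsilon> > (0::real)"
  shows "\<forall>\<^sub>F z in F. \<bar>f z - g z\<bar> \<le> \<epsilon> * \<bar>g z :: real\<bar>"
  using landau_o.smallD[OF asymp_equiv_altdef[THEN iffD1, OF assms(1)] assms(2)] by simp

text \<open>A joint limit inside \<open>D\<close> controls both iterated limits from the left as
  long as the nested approach stays in \<open>D\<close>: a disc of radius \<open>d\<close> contains
  the box of half-width \<open>d / 2\<close>, and points strictly left of \<open>a\<close> and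
  \<open>b\<close> avoid the centre.\<close>

lemma eventually_at_within_Times_at_left:
  fixes a b :: real
  assumes P: "\<forall>\<^sub>F z in at (a, b) within D. P z"
  shows "\<forall>\<^sub>F x in at_left a. \<forall>\<^sub>F y in at_left b. (x, y) \<in> D \<Longrightarrow>
      \<forall>\<^sub>F x in at_left a. \<forall>\<^sub>F y in at_left b. P (x, y)"
    and "\<forall>\<^sub>F y in at_left b. \<forall>\<^sub>F x in at_left a. (x, y) \<in> D \<Longrightarrow>
      \<forall>\<^sub>F y in at_left b. \<forall>\<^sub>F x in at_left a. P (x, y)"
proof -
  obtain d where d: "d > 0" "\<And>z. z \<in> D \<Longrightarrow> z \<noteq> (a, b) \<Longrightarrow> dist z (a, b) < d \<Longrightarrow> P z"
    using P by (auto simp: eventually_at)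
  have box: "P (x, y)" if "(x, y) \<in> D" "a - d / 2 < x \<and> x < a" "b - d / 2 < y \<and> y < b" for x y
  proof (rule d(2))
    have "dist (x, y) (a, b) \<le> \<bar>x - a\<bar> + \<bar>y - b\<bar>"
      using sqrt_sum_squares_le_sum_abs[of "x - a" "y - b"] by (simp add: dist_Pair_Pair dist_real_def)
    also have "\<dots> < d" using that by auto
    finally show "dist (x, y) (a, b) < d" .
  qed (use that in auto)
  have ev: "\<forall>\<^sub>F x in at_left a. a - d / 2 < x \<and> x < a" for a
    using eventually_at_left_real[of "a - d / 2" a] d(1) by (auto elim: eventually_mono)
  show "\<forall>\<^sub>F x in at_left a. \<forall>\<^sub>F y in at_left b. P (x, y)"
    if "\<forall>\<^sub>F x in at_left a. \<forall>\<^sub>F y in at_left b. (x, y) \<in> D"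
    using that ev[of a]
  proof eventually_elim
    case (elim x)
    from elim(1) ev[of b] show ?case
      by eventually_elim (use box elim(2) in blast)
  qed
  show "\<forall>\<^sub>F y in at_left b. \<forall>\<^sub>F x in at_left a. P (x, y)"
    if "\<forall>\<^sub>F y in at_left b. \<forall>\<^sub>F x in at_left a. (x, y) \<in> D"
    using that ev[of b]
  proof eventually_elim
    case (elim y)
    from elim(1) ev[of a] show ?case
      by eventually_elim (use box elim(2) in blast)
  qed
qed

section \<open>Double series\<close>

lemma summable_on_swap_UNIV:
  fixes u :: "'a \<Rightarrow> 'b \<Rightarrow> real"
  assumes "(\<lambda>(m, n). u m n) summable_on UNIV"
  shows "(\<lambda>(n, m). u m n) summable_on UNIV"
  using summable_on_swap[of "\<lambda>(m, n). u m n" UNIV UNIV] assms by (simp add: case_prod_unfold)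

text \<open>The bridge between unconditional sums over pairs, where the order of summation may be
  exchanged, and the ordered series \<open>suminf\<close> used for power series.\<close>

lemma summable_infsum_rows:
  fixes u :: "nat \<Rightarrow> nat \<Rightarrow> real"
  assumes "(\<lambda>(m, n). u m n) summable_on UNIV"
  shows "u m summable_on UNIV"
    and "summable (\<lambda>m. \<Sum>\<^sub>\<infinity>n. u m n)"
    and "(\<Sum>m. \<Sum>\<^sub>\<infinity>n. u m n) = (\<Sum>\<^sub>\<infinity>(m, n). u m n)"
proof -
  have a: "(\<lambda>(m, n). u m n) summable_on UNIV \<times> UNIV" using assms by simp
  show r: "u m summable_on UNIV" for m
    using summable_on_SigmaD1[OF a, of m] by simp
  have s: "(\<lambda>m. \<Sum>\<^sub>\<infinity>n. u m n) summable_on UNIV"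
    using summable_on_SigmaD[OF a] r by simp
  then show "summable (\<lambda>m. \<Sum>\<^sub>\<infinity>n. u m n)"
    by (rule summable_on_imp_summable)
  have "(\<Sum>m. \<Sum>\<^sub>\<infinity>n. u m n) = (\<Sum>\<^sub>\<infinity>m. \<Sum>\<^sub>\<infinity>n. u m n)"
    using has_sum_imp_sums[OF has_sum_infsum[OF s]] by (simp add: sums_iff)
  also have "\<dots> = (\<Sum>\<^sub>\<infinity>(m, n). u m n)"
    using infsum_Sigma'_banach[OF a] by simp
  finally show "(\<Sum>m. \<Sum>\<^sub>\<infinity>n. u m n) = (\<Sum>\<^sub>\<infinity>(m, n). u m n)" .
qed

lemma summable_on_UNIV_comparison:
  fixes u v :: "nat \<Rightarrow> nat \<Rightarrow> real"
  assumes "(\<lambda>(m, n). v m n) summable_on UNIV" "\<And>m n. \<bar>u m n\<bar> \<le> v m n"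
  shows "(\<lambda>(m, n). u m n) summable_on UNIV"
proof -
  have "(\<lambda>z. norm (case z of (m, n) \<Rightarrow> u m n)) summable_on UNIV"
    by (rule Infinite_Sum.abs_summable_on_comparison_test'[OF assms(1)]) (use assms(2) in auto)
  then show ?thesis by (rule abs_summable_summable)
qed

lemma summable_on_UNIV_abs:
  fixes u :: "nat \<Rightarrow> nat \<Rightarrow> real"
  assumes "(\<lambda>(m, n). u m n) summable_on UNIV"
  shows "(\<lambda>(m, n). \<bar>u m n\<bar>) summable_on UNIV"
  using assms unfolding summable_on_iff_abs_summable_on_real[of "\<lambda>(m, n). u m n"]
  by (simp add: case_prod_unfold)

lemma summable_on_UNIV_nonneg_rows:
  fixes u :: "nat \<Rightarrow> nat \<Rightarrow> real"
  assumes "\<And>m n. 0 \<le> u m n" "\<And>m. u m summable_on UNIV" "summable (\<lambda>m. \<Sum>\<^sub>\<infinity>n. u m n)"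
  shows "(\<lambda>(m, n). u m n) summable_on UNIV"
proof -
  have "(\<lambda>(m, n). u m n) summable_on UNIV \<times> UNIV"
  proof (rule summable_on_SigmaI)
    show "((\<lambda>n. case (m, n) of (m, n) \<Rightarrow> u m n) has_sum (\<Sum>\<^sub>\<infinity>n. u m n)) UNIV" for m
      using has_sum_infsum[OF assms(2)] by simp
    show "(\<lambda>m. \<Sum>\<^sub>\<infinity>n. u m n) summable_on UNIV"
      using assms by (intro summable_nonneg_imp_summable_on) (auto intro: infsum_nonneg)
  qed (use assms in auto)
  then show ?thesis by simp
qed

lemma gf_converges_mono:
  assumes "gf_converges u x r" "0 \<le> q" "q \<le> r"
  shows "gf_converges u x q"
  unfolding gf_converges_def
proof (rule summable_on_UNIV_comparison)
  show "(\<lambda>(m, n). \<bar>u m n * x ^ m * r ^ n\<bar>) summable_on UNIV"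
    using assms(1) unfolding gf_converges_def by (rule summable_on_UNIV_abs)
  show "\<bar>u m n * x ^ m * q ^ n\<bar> \<le> \<bar>u m n * x ^ m * r ^ n\<bar>" for m n
    using assms by (auto simp: abs_mult intro!: mult_left_mono power_mono)
qed

lemma infsum_diff_real:
  fixes f g :: "'a \<Rightarrow> real"
  assumes "f summable_on A" "g summable_on A"
  shows "(\<lambda>x. f x - g x) summable_on A"
    and "(\<Sum>\<^sub>\<infinity>x\<in>A. f x - g x) = infsum f A - infsum g A"
proof -
  have "((\<lambda>x. f x + - g x) has_sum (infsum f A + - infsum g A)) A"
    by (intro has_sum_add has_sum_infsum assms) (simp add: has_sum_uminus assms)
  then have "((\<lambda>x. f x - g x) has_sum (infsum f A - infsum g A)) A"
    by simp
  then show "(\<lambda>x. f x - g x) summable_on A" "(\<Sum>\<^sub>\<infinity>x\<in>A. f x - g x) = infsum f A - infsum g A"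
    by (auto simp: infsumI has_sum_imp_summable)
qed

lemma gf_diff:
  assumes "gf_converges u x q" "gf_converges v x q"
  shows "gf_converges (\<lambda>m n. u m n - v m n) x q"
    and "gf (\<lambda>m n. u m n - v m n) x q = gf u x q - gf v x q"
proof -
  have eq: "(\<lambda>(m, n). (u m n - v m n) * x ^ m * q ^ n) =
      (\<lambda>z. (case z of (m, n) \<Rightarrow> u m n * x ^ m * q ^ n) - (case z of (m, n) \<Rightarrow> v m n * x ^ m * q ^ n))"
    by (auto simp: algebra_simps)
  show "gf_converges (\<lambda>m n. u m n - v m n) x q"
    unfolding gf_converges_def eq by (intro infsum_diff_real) (use assms in \<open>auto simp: gf_converges_def\<close>)
  show "gf (\<lambda>m n. u m n - v m n) x q = gf u x q - gf v x q"
    unfolding gf_def eq by (intro infsum_diff_real) (use assms in \<open>auto simp: gf_converges_def\<close>)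
qed

text \<open>For fixed \<open>x\<close> the double series is a power series in \<open>q\<close> whose
  coefficients are the column sums. Absolute summability at \<open>q = r\<close>, with and without
  the binomial weights, permits Abel's theorem in \<open>q\<close> and then the return to a power
  series in \<open>x\<close>.\<close>

lemma tendsto_iterated_deriv_gf:
  fixes u :: "nat \<Rightarrow> nat \<Rightarrow> real"
  assumes r: "0 < r"
    and conv: "gf_converges u x r"
    and sk: "(\<lambda>(m, n). real (n choose k) * u m n * r ^ (n - k) * x ^ m) summable_on UNIV"
    and f: "\<And>q. 0 < q \<Longrightarrow> q < r \<Longrightarrow> f q = gf u x q"
  shows "summable (\<lambda>m. (\<Sum>\<^sub>\<infinity>n. real (n choose k) * u m n * r ^ (n - k)) * x ^ m)"
    and "((deriv ^^ k) f \<longlongrightarrow>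
      fact k * (\<Sum>m. (\<Sum>\<^sub>\<infinity>n. real (n choose k) * u m n * r ^ (n - k)) * x ^ m)) (at_left r)"
proof -
  let ?U = "\<lambda>q m n. u m n * x ^ m * q ^ n"
  let ?a = "\<lambda>n. \<Sum>\<^sub>\<infinity>m. u m n * x ^ m"
  let ?K = "\<lambda>m n. real (n choose k) * u m n * r ^ (n - k) * x ^ m"
  note s0 = conv[unfolded gf_converges_def]
  have sq: "(\<lambda>(m, n). ?U q m n) summable_on UNIV" if "0 < q" "q < r" for q
    using gf_converges_mono[OF conv, of q] that by (simp add: gf_converges_def)
  \<comment> \<open>The columns are summable because the factor \<open>r ^ n\<close> is constant
    along each of them and can be divided out.\<close>
  have col: "(\<lambda>m. \<bar>u m n * x ^ m\<bar>) summable_on UNIV" for n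
  proof -
    have "(\<lambda>m. \<bar>?U r m n\<bar> * inverse (r ^ n)) summable_on UNIV"
      by (intro summable_on_cmult_left
        summable_infsum_rows(1)[OF summable_on_swap_UNIV[OF summable_on_UNIV_abs[OF s0]]])
    moreover have "\<bar>?U r m n\<bar> * inverse (r ^ n) = \<bar>u m n * x ^ m\<bar>" for m
      using r by (simp add: abs_mult)
    ultimately show ?thesis by simp
  qed
  have "summable (\<lambda>n. \<Sum>\<^sub>\<infinity>m. \<bar>?U r m n\<bar>)"
    by (rule summable_infsum_rows(2)[OF summable_on_swap_UNIV[OF summable_on_UNIV_abs[OF s0]]])
  then have A: "summable (\<lambda>n. (\<Sum>\<^sub>\<infinity>m. \<bar>u m n * x ^ m\<bar>) * r ^ n)"
    using r by (simp add: abs_mult infsum_cmult_left')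
  have "summable (\<lambda>n. \<Sum>\<^sub>\<infinity>m. \<bar>?K m n\<bar>)"
    by (rule summable_infsum_rows(2)[OF summable_on_swap_UNIV[OF summable_on_UNIV_abs[OF sk]]])
  moreover have "(\<Sum>\<^sub>\<infinity>m. \<bar>?K m n\<bar>) = real (n choose k) * (\<Sum>\<^sub>\<infinity>m. \<bar>u m n * x ^ m\<bar>) * r ^ (n - k)" for n
    unfolding infsum_cmult_right'[symmetric] infsum_cmult_left'[symmetric]
    using r by (intro infsum_cong) (simp add: abs_mult)
  ultimately have B: "summable (\<lambda>n. real (n choose k) * (\<Sum>\<^sub>\<infinity>m. \<bar>u m n * x ^ m\<bar>) * r ^ (n - k))"
    by simp
  have le: "\<bar>?a n\<bar> \<le> (\<Sum>\<^sub>\<infinity>m. \<bar>u m n * x ^ m\<bar>)" for n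
    using norm_infsum_bound[of "\<lambda>m. u m n * x ^ m" UNIV] col[of n] by simp
  have fa: "f q = (\<Sum>n. ?a n * q ^ n)" if "0 < q" "q < r" for q
  proof -
    have "f q = (\<Sum>\<^sub>\<infinity>(n, m). ?U q m n)"
      using f[OF that] infsum_swap_banach[of "?U q" UNIV UNIV] sq[OF that]
        infsum_Sigma'_banach[of "?U q" UNIV "\<lambda>_. UNIV"]
        infsum_Sigma'_banach[of "\<lambda>n m. ?U q m n" UNIV "\<lambda>_. UNIV"]
        summable_on_swap_UNIV[OF sq[OF that]]
      by (simp add: gf_def)
    also have "\<dots> = (\<Sum>n. \<Sum>\<^sub>\<infinity>m. ?U q m n)"
      by (rule summable_infsum_rows(3)[symmetric]) (rule summable_on_swap_UNIV[OF sq[OF that]])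
    finally show ?thesis
      by (simp add: infsum_cmult_left')
  qed
  have "((deriv ^^ k) f \<longlongrightarrow> fact k * (\<Sum>n. real (n choose k) * ?a n * r ^ (n - k))) (at_left r)"
  proof (rule tendsto_iterated_deriv_powser_at_left[OF r _ _ fa])
    show "summable (\<lambda>n. \<bar>?a n\<bar> * r ^ n)"
      by (rule summable_comparison_test'[OF A, of 0])
        (use le r in \<open>auto simp: abs_mult intro!: mult_right_mono\<close>)
    show "summable (\<lambda>n. real (n choose k) * \<bar>?a n\<bar> * r ^ (n - k))"
      by (rule summable_comparison_test'[OF B, of 0])
        (use le r in \<open>auto simp: abs_mult intro!: mult_right_mono mult_left_mono\<close>)
  qed
  also have "(\<lambda>n. real (n choose k) * ?a n * r ^ (n - k)) = (\<lambda>n. \<Sum>\<^sub>\<infinity>m. ?K m n)"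
  proof
    show "real (n choose k) * ?a n * r ^ (n - k) = (\<Sum>\<^sub>\<infinity>m. ?K m n)" for n
      unfolding infsum_cmult_right'[symmetric] infsum_cmult_left'[symmetric]
      by (intro infsum_cong) simp
  qed
  also have "(\<Sum>n. \<Sum>\<^sub>\<infinity>m. ?K m n) = (\<Sum>\<^sub>\<infinity>(n, m). ?K m n)"
    by (rule summable_infsum_rows(3)) (rule summable_on_swap_UNIV[OF sk])
  \<comment> \<open>The order of summation is exchanged here, so that the limit becomes a series in
    powers of \<open>x\<close>.\<close>
  also have "\<dots> = (\<Sum>\<^sub>\<infinity>(m, n). ?K m n)"
    using infsum_swap_banach[of ?K UNIV UNIV] sk
        infsum_Sigma'_banach[of ?K UNIV "\<lambda>_. UNIV"]
        infsum_Sigma'_banach[of "\<lambda>n m. ?K m n" UNIV "\<lambda>_. UNIV"]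
        summable_on_swap_UNIV[OF sk]
      by simp
  also have "\<dots> = (\<Sum>m. \<Sum>\<^sub>\<infinity>n. ?K m n)"
    by (rule summable_infsum_rows(3)[OF sk, symmetric])
  finally show "((deriv ^^ k) f \<longlongrightarrow>
      fact k * (\<Sum>m. (\<Sum>\<^sub>\<infinity>n. real (n choose k) * u m n * r ^ (n - k)) * x ^ m)) (at_left r)"
    by (simp add: infsum_cmult_left')
  show "summable (\<lambda>m. (\<Sum>\<^sub>\<infinity>n. real (n choose k) * u m n * r ^ (n - k)) * x ^ m)"
    using summable_infsum_rows(2)[OF sk] by (simp add: infsum_cmult_left')
qed

section \<open>Coefficients of the generating function\<close>

lemma finite_support_infsum:
  fixes w :: "nat \<Rightarrow> real"
  assumes "finite S" "\<And>n. n \<notin> S \<Longrightarrow> w n = 0"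
  shows "w summable_on UNIV" and "infsum w UNIV = sum w S" and "suminf w = sum w S"
proof -
  show "w summable_on UNIV"
    using assms by (subst summable_on_cong_neutral[of S UNIV w w]) auto
  show "infsum w UNIV = sum w S"
    using assms infsum_cong_neutral[of S UNIV w w] by auto
  show "suminf w = sum w S"
    using assms by (intro suminf_finite) auto
qed

text \<open>A finite sum is a power series that converges everywhere. The formula puts the
  derivative coefficients into the shape in which they arise from the double series.\<close>

lemma iterated_deriv_finite_powser_div_fact:
  fixes v :: "nat \<Rightarrow> nat"
  assumes fin: "finite {n. v n \<noteq> 0}"
  shows "(deriv ^^ k) (\<lambda>q. \<Sum>n | v n \<noteq> 0. real (v n) * q ^ n) x / fact k =
    (\<Sum>\<^sub>\<infinity>n. real (n choose k) * real (v n) * x ^ (n - k))"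
proof -
  let ?f = "\<lambda>q. \<Sum>n | v n \<noteq> 0. real (v n) * q ^ n"
  have s: "summable (\<lambda>n. real (v n) * q ^ n)" for q :: real
    by (rule summable_finite[OF fin]) auto
  have f: "?f q = (\<Sum>n. real (v n) * q ^ n)" for q :: real
    by (rule suminf_finite[OF fin, symmetric]) auto
  have "(deriv ^^ k) ?f x = fact k * (\<Sum>n. real (n choose k) * real (v n) * x ^ (n - k))"
    by (rule iterated_deriv_powser(2)[where R = "\<bar>x\<bar> + 1" and S = "ball 0 (\<bar>x\<bar> + 1)"])
      (use s f in auto)
  also have "(\<Sum>n. real (n choose k) * real (v n) * x ^ (n - k)) =
      (\<Sum>\<^sub>\<infinity>n. real (n choose k) * real (v n) * x ^ (n - k))"
    using finite_support_infsum(2,3)[OF fin, of "\<lambda>n. real (n choose k) * real (v n) * x ^ (n - k)"] by simp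
  finally show ?thesis by simp
qed

text \<open>Each factor \<open>n\<close> comes from differentiating termwise and multiplying by
  \<open>x\<close>, and neither operation shrinks the open disc of convergence.\<close>

lemma summable_poly_mult_powser:
  fixes a :: "nat \<Rightarrow> real"
  assumes "\<bar>x\<bar> < R" "\<And>x. \<bar>x\<bar> < R \<Longrightarrow> summable (\<lambda>n. a n * x ^ n)"
  shows "summable (\<lambda>n. real n ^ j * a n * x ^ n)"
  using assms(1)
proof (induction j arbitrary: x)
  case 0
  then show ?case using assms(2) by simp
next
  case (Suc j)
  have "summable (\<lambda>n. diffs (\<lambda>n. real n ^ j * a n) n * x ^ n)"
    using termdiff_converges[of x R "\<lambda>n. real n ^ j * a n"] Suc by simp
  then have "summable (\<lambda>n. x * (diffs (\<lambda>n. real n ^ j * a n) n * x ^ n))"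
    by (rule summable_mult)
  moreover have "x * (diffs (\<lambda>n. real n ^ j * a n) n * x ^ n) = real (Suc n) ^ Suc j * a (Suc n) * x ^ Suc n" for n
    by (simp add: diffs_def)
  ultimately show ?case
    using summable_Suc_iff[of "\<lambda>n. real n ^ Suc j * a n * x ^ n"] by (simp only:)
qed

lemma binomial_le_power: "n choose k \<le> n ^ k"
  by (cases "k \<le> n") (auto intro: binomial_le_pow simp: binomial_eq_0)

text \<open>The geometric gain from \<open>q < q'\<close> absorbs the polynomial size of the
  binomial coefficient: \<open>real n ^ k * (q / q') ^ n\<close> is bounded because its series
  converges.\<close>

lemma binomial_power_bound:
  fixes q q' :: real
  assumes "0 < q" "q < q'"
  obtains C where "C \<ge> 0" "\<And>n. real (n choose k) * q ^ (n - k) \<le> C * q' ^ n"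
proof -
  have s: "summable (\<lambda>n. 1 * (q / q') ^ n)" "\<And>x. \<bar>x\<bar> < 1 \<Longrightarrow> summable (\<lambda>n. 1 * x ^ n :: real)"
    using assms by (simp_all add: summable_geometric)
  have "summable (\<lambda>n. real n ^ k * 1 * (q / q') ^ n)"
    by (rule summable_poly_mult_powser[of _ 1]) (use assms s in auto)
  then obtain C where C: "\<And>n. real n ^ k * (q / q') ^ n \<le> C"
    using summable_imp_Bseq[of "\<lambda>n. real n ^ k * 1 * (q / q') ^ n"] unfolding Bseq_def by (auto simp: abs_le_iff)
  show ?thesis
  proof
    \<comment> \<open>The division by \<open>q ^ k\<close> accounts for the exponent
      \<open>n - k\<close> in place of \<open>n\<close>.\<close>
    show "0 \<le> \<bar>C\<bar> / q ^ k" using assms by simp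
    show "real (n choose k) * q ^ (n - k) \<le> \<bar>C\<bar> / q ^ k * q' ^ n" for n
    proof (cases "k \<le> n")
      case True
      have "real (n choose k) * q ^ (n - k) = real (n choose k) * (q / q') ^ n * q' ^ n / q ^ k"
        using assms True by (simp add: power_diff power_divide)
      also have "\<dots> \<le> real n ^ k * (q / q') ^ n * q' ^ n / q ^ k"
        using assms binomial_le_power[of n k] by (intro divide_right_mono mult_right_mono) (auto simp flip: of_nat_power)
      also have "\<dots> \<le> \<bar>C\<bar> * q' ^ n / q ^ k"
        using assms C[of n] by (intro divide_right_mono mult_right_mono) auto
      finally show ?thesis by simp
    qed (use assms in \<open>auto simp: binomial_eq_0\<close>)
  qed
qed

text \<open>Intended for the regular part, which converges beyond the critical point and so leaves
  room for a larger \<open>q'\<close>. The singular series has no such room and is treated through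
  the growth assumption.\<close>

lemma gf_converges_deriv:
  fixes c :: "nat \<Rightarrow> nat \<Rightarrow> real"
  assumes "gf_converges c x q'" "0 < x" "0 < q" "q < q'"
  shows "(\<lambda>(m, n). real (n choose k) * c m n * q ^ (n - k) * x ^ m) summable_on UNIV"
proof -
  obtain C where C: "C \<ge> 0" "\<And>n. real (n choose k) * q ^ (n - k) \<le> C * q' ^ n"
    using binomial_power_bound[OF assms(3,4)] by metis
  have "(\<lambda>(m, n). \<bar>c m n * x ^ m * q' ^ n\<bar>) summable_on UNIV"
    using assms(1) unfolding gf_converges_def by (rule summable_on_UNIV_abs)
  then have "(\<lambda>z. C * (case z of (m, n) \<Rightarrow> \<bar>c m n * x ^ m * q' ^ n\<bar>)) summable_on UNIV"
    by (rule summable_on_cmult_right)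
  then have "(\<lambda>(m, n). C * \<bar>c m n * x ^ m * q' ^ n\<bar>) summable_on UNIV"
    by (simp add: case_prod_unfold)
  then show ?thesis
  proof (rule summable_on_UNIV_comparison)
    fix m n
    have "\<bar>real (n choose k) * c m n * q ^ (n - k) * x ^ m\<bar> = \<bar>c m n\<bar> * x ^ m * (real (n choose k) * q ^ (n - k))"
      using assms by (simp add: abs_mult)
    also have "\<dots> \<le> \<bar>c m n\<bar> * x ^ m * (C * q' ^ n)"
      using assms by (intro mult_left_mono C) auto
    also have "\<dots> = C * \<bar>c m n * x ^ m * q' ^ n\<bar>"
      using assms by (simp add: abs_mult)
    finally show "\<bar>real (n choose k) * c m n * q ^ (n - k) * x ^ m\<bar> \<le> C * \<bar>c m n * x ^ m * q' ^ n\<bar>" .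
  qed
qed

text \<open>Transposing the coefficients interchanges the two variables, which lets the second case
  of the theorem use the same comparison argument as the first.\<close>

lemma gf_swap: "gf (\<lambda>n m. c m n) q x = gf c x q"
  unfolding gf_def
  using infsum_reindex_bij_betw[of prod.swap UNIV UNIV "\<lambda>(m, n). c m n * x ^ m * q ^ n"]
  by (simp add: case_prod_unfold mult_ac)

lemma gf_converges_swap: "gf_converges (\<lambda>n m. c m n) q x \<longleftrightarrow> gf_converges c x q"
  unfolding gf_converges_def
  using summable_on_reindex_bij_betw[of prod.swap UNIV UNIV "\<lambda>(m, n). c m n * x ^ m * q ^ n"]
  by (simp add: case_prod_unfold mult_ac)

section \<open>Supports and radii of convergence under the growth assumption\<close>

lemma polygon_growthE:
  assumes "polygon_growth p"
  obtains A B where "A > 0" "B > 0" "\<And>m n. p m n \<noteq> 0 \<Longrightarrow> A * real m < real n"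
    "\<And>m n. p m n \<noteq> 0 \<Longrightarrow> real n < B * real m ^ 2"
    "\<And>m. finite {n. p m n \<noteq> 0}" "\<And>n. finite {m. p m n \<noteq> 0}"
proof -
  obtain A B where AB: "A > 0" "B > 0" "\<And>m n. p m n \<noteq> 0 \<Longrightarrow> A * real m < real n"
    "\<And>m n. p m n \<noteq> 0 \<Longrightarrow> real n < B * real m ^ 2"
    using assms unfolding polygon_growth_def by (meson not_le)
  moreover have "finite {n. p m n \<noteq> 0}" for m
  proof (rule finite_subset)
    show "{n. p m n \<noteq> 0} \<subseteq> {..nat \<lceil>B * real m ^ 2\<rceil>}"
    proof
      fix n assume "n \<in> {n. p m n \<noteq> 0}"
      then have "real n < B * real m ^ 2" using AB(4) by simp
      then have "n \<le> nat \<lceil>B * real m ^ 2\<rceil>" by linarith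
      then show "n \<in> {..nat \<lceil>B * real m ^ 2\<rceil>}" by simp
    qed
  qed simp
  moreover have "finite {m. p m n \<noteq> 0}" for n
  proof (rule finite_subset)
    show "{m. p m n \<noteq> 0} \<subseteq> {..nat \<lceil>real n / A\<rceil>}"
    proof
      fix m assume "m \<in> {m. p m n \<noteq> 0}"
      then have "real m \<le> real n / A" using AB(1) AB(3)[of m n] by (simp add: field_simps)
      then have "m \<le> nat \<lceil>real n / A\<rceil>" by linarith
      then show "m \<in> {..nat \<lceil>real n / A\<rceil>}" by simp
    qed
  qed simp
  ultimately show thesis using that by blast
qed

lemma q_deriv_coeff_eq_infsum:
  assumes "polygon_growth p"
  shows "q_deriv_coeff p k m = (\<Sum>\<^sub>\<infinity>n. real (n choose k) * real (p m n) * 1 ^ (n - k))"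
  using polygon_growthE[OF assms] iterated_deriv_finite_powser_div_fact[of "p m" k 1]
  unfolding q_deriv_coeff_def by metis

lemma x_deriv_coeff_eq_infsum:
  assumes "polygon_growth p"
  shows "x_deriv_coeff p xc k n = (\<Sum>\<^sub>\<infinity>m. real (m choose k) * real (p m n) * xc ^ (m - k))"
  using polygon_growthE[OF assms] iterated_deriv_finite_powser_div_fact[of "\<lambda>m. p m n" k xc]
  unfolding x_deriv_coeff_def by metis

lemma q_deriv_coeff_eq_sum:
  assumes "polygon_growth p"
  shows "q_deriv_coeff p k m = (\<Sum>n | p m n \<noteq> 0. real (n choose k) * real (p m n))"
proof -
  have "finite {n. p m n \<noteq> 0}" using polygon_growthE[OF assms] by metis
  then show ?thesis
    unfolding q_deriv_coeff_eq_infsum[OF assms] by (subst finite_support_infsum(2)) auto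
qed

text \<open>On the support \<open>n < B * m ^ 2\<close>, so the binomial weight is at most
  polynomial in \<open>m\<close>; and \<open>n > A * m\<close>, so for large \<open>m\<close> the
  weight is at least 1. Up to a polynomial factor the coefficients are thus the row sums, which
  fixes their radius of convergence.\<close>

lemma q_deriv_coeff_bounds:
  assumes "polygon_growth p"
  shows "\<exists>C\<ge>0. \<forall>m. q_deriv_coeff p k m \<le> C * real m ^ (2 * k) * real (row_sum p m)"
    and "\<forall>\<^sub>F m in sequentially. real (row_sum p m) \<le> q_deriv_coeff p k m"
    and "0 \<le> q_deriv_coeff p k m"
proof -
  from assms obtain A B where AB: "A > 0" "B > 0" "\<And>m n. p m n \<noteq> 0 \<Longrightarrow> A * real m < real n"
    "\<And>m n. p m n \<noteq> 0 \<Longrightarrow> real n < B * real m ^ 2" and fin: "\<And>m. finite {n. p m n \<noteq> 0}"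
    by (rule polygon_growthE) metis
  have row: "real (row_sum p m) = (\<Sum>n | p m n \<noteq> 0. real (p m n))" for m
    by (simp add: row_sum_def)
  note eq = q_deriv_coeff_eq_sum[OF assms]
  have "q_deriv_coeff p k m \<le> B ^ k * real m ^ (2 * k) * real (row_sum p m)" for m
    unfolding eq row sum_distrib_left
  proof (intro sum_mono mult_right_mono)
    fix n assume n: "n \<in> {n. p m n \<noteq> 0}"
    have "real (n choose k) \<le> real n ^ k"
      using binomial_le_power[of n k] by (simp flip: of_nat_power)
    also have "\<dots> \<le> (B * real m ^ 2) ^ k"
      using AB(4)[of m n] n by (intro power_mono) auto
    finally show "real (n choose k) \<le> B ^ k * real m ^ (2 * k)"
      by (simp add: power_mult_distrib power_mult)
  qed simp
  then show "\<exists>C\<ge>0. \<forall>m. q_deriv_coeff p k m \<le> C * real m ^ (2 * k) * real (row_sum p m)"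
    using AB(2) by (intro exI[of _ "B ^ k"]) simp
  have "\<forall>\<^sub>F m in sequentially. real k / A \<le> real m"
    using filterlim_real_sequentially unfolding filterlim_at_top by blast
  then show "\<forall>\<^sub>F m in sequentially. real (row_sum p m) \<le> q_deriv_coeff p k m"
  proof eventually_elim
    case (elim m)
    show ?case unfolding eq row
    proof (rule sum_mono)
      fix n assume n: "n \<in> {n. p m n \<noteq> 0}"
      have "real k \<le> A * real m" using elim AB(1) by (simp add: field_simps)
      also have "\<dots> < real n" using AB(3)[of m n] n by simp
      finally have "1 \<le> n choose k" by (simp add: Suc_le_eq)
      then show "real (p m n) \<le> real (n choose k) * real (p m n)"
        using mult_right_mono[of 1 "real (n choose k)" "real (p m n)"] by simp
    qed
  qed
  show "0 \<le> q_deriv_coeff p k m" unfolding eq by (simp add: sum_nonneg)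
qed

lemma summable_poly_row_sum:
  assumes "conv_radius (\<lambda>m. real (row_sum p m)) = ereal xc" "0 \<le> x" "x < xc"
  shows "summable (\<lambda>m. real m ^ j * real (row_sum p m) * x ^ m)"
  by (rule summable_poly_mult_powser[of _ xc])
    (use assms in \<open>auto intro!: summable_in_conv_radius\<close>)

lemma summable_q_deriv_coeff:
  assumes "polygon_growth p" "conv_radius (\<lambda>m. real (row_sum p m)) = ereal xc" "0 < x" "x < xc"
  shows "summable (\<lambda>m. q_deriv_coeff p k m * x ^ m)"
proof -
  obtain C where C: "C \<ge> 0" "\<And>m. q_deriv_coeff p k m \<le> C * real m ^ (2 * k) * real (row_sum p m)"
    using q_deriv_coeff_bounds(1)[OF assms(1)] by metis
  have "summable (\<lambda>m. C * (real m ^ (2 * k) * real (row_sum p m) * x ^ m))"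
    using assms by (intro summable_mult summable_poly_row_sum) auto
  then show ?thesis
  proof (rule summable_comparison_test'[of _ 0])
    show "norm (q_deriv_coeff p k m * x ^ m) \<le> C * (real m ^ (2 * k) * real (row_sum p m) * x ^ m)" for m
      using mult_right_mono[OF C(2)[of m], of "x ^ m"] q_deriv_coeff_bounds(3)[OF assms(1), of k m] assms(3)
      by (simp add: abs_mult mult_ac)
  qed
qed

lemma conv_radius_q_deriv_coeff:
  assumes "polygon_growth p" "conv_radius (\<lambda>m. real (row_sum p m)) = ereal xc" "0 < xc"
  shows "conv_radius (q_deriv_coeff p k) = ereal xc"
proof (rule antisym)
  show "ereal xc \<le> conv_radius (q_deriv_coeff p k)"
    by (rule conv_radius_geI_ex') (use summable_q_deriv_coeff[OF assms(1,2)] in auto)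
  show "conv_radius (q_deriv_coeff p k) \<le> ereal xc"
  proof (rule conv_radius_leI_ex')
    fix r :: real assume r: "0 < r" "ereal xc < ereal r"
    show "\<not> summable (\<lambda>m. q_deriv_coeff p k m * of_real r ^ m)"
    proof
      assume s: "summable (\<lambda>m. q_deriv_coeff p k m * of_real r ^ m)"
      have "summable (\<lambda>m. real (row_sum p m) * r ^ m)"
      proof (rule summable_comparison_test_ev[OF _ s])
        show "\<forall>\<^sub>F m in sequentially. norm (real (row_sum p m) * r ^ m) \<le> q_deriv_coeff p k m * of_real r ^ m"
          using q_deriv_coeff_bounds(2)[OF assms(1), of k] r(1)
          by (auto elim!: eventually_mono intro!: mult_right_mono)
      qed
      then show False
        using not_summable_outside_conv_radius[of "\<lambda>m. real (row_sum p m)" r] assms(2) r by simp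
    qed
  qed (use assms(3) in simp)
qed

lemma summable_on_q_deriv:
  assumes "polygon_growth p" "conv_radius (\<lambda>m. real (row_sum p m)) = ereal xc" "0 < x" "x < xc"
  shows "(\<lambda>(m, n). real (n choose k) * real (p m n) * 1 ^ (n - k) * x ^ m) summable_on UNIV"
proof (rule summable_on_UNIV_nonneg_rows)
  have fin: "finite {n. p m n \<noteq> 0}" for m
    using polygon_growthE[OF assms(1)] by metis
  show "(\<lambda>n. real (n choose k) * real (p m n) * 1 ^ (n - k) * x ^ m) summable_on UNIV" for m
    by (rule finite_support_infsum(1)[OF fin[of m]]) auto
  show "summable (\<lambda>m. \<Sum>\<^sub>\<infinity>n. real (n choose k) * real (p m n) * 1 ^ (n - k) * x ^ m)"
    using summable_q_deriv_coeff[OF assms, of k]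
    unfolding q_deriv_coeff_eq_infsum[OF assms(1)] infsum_cmult_left' .
qed (use assms in auto)

text \<open>Since \<open>n > A * m\<close> on the support, replacing \<open>q ^ n\<close> by
  \<open>(q powr A) ^ m\<close> overestimates for \<open>q \<le> 1\<close> and underestimates for
  \<open>q \<ge> 1\<close>. In effect \<open>q\<close> rescales the argument of the row-sum series
  by \<open>q powr A\<close>.\<close>

lemma infsum_row_bounds:
  assumes "polygon_growth p"
  obtains A where "A > 0"
    "\<And>q m. 0 < q \<Longrightarrow> q \<le> 1 \<Longrightarrow> (\<Sum>\<^sub>\<infinity>n. real (p m n) * q ^ n) \<le> real (row_sum p m) * (q powr A) ^ m"
    "\<And>q m. 1 \<le> q \<Longrightarrow> real (row_sum p m) * (q powr A) ^ m \<le> (\<Sum>\<^sub>\<infinity>n. real (p m n) * q ^ n)"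
    "\<And>q m. (\<lambda>n. real (p m n) * q ^ n) summable_on UNIV"
proof -
  from assms obtain A where A: "A > 0" "\<And>m n. p m n \<noteq> 0 \<Longrightarrow> A * real m < real n"
    and fin: "\<And>m. finite {n. p m n \<noteq> 0}"
    by (rule polygon_growthE) metis
  have eq: "(\<Sum>\<^sub>\<infinity>n. real (p m n) * q ^ n) = (\<Sum>n | p m n \<noteq> 0. real (p m n) * q ^ n)" for m and q :: real
    by (rule finite_support_infsum(2)[OF fin]) auto
  have row: "real (row_sum p m) * z = (\<Sum>n | p m n \<noteq> 0. real (p m n) * z)" for m z
    by (simp add: row_sum_def sum_distrib_right)
  have pow: "(q powr A) ^ m = q powr (A * real m)" "q ^ n = q powr real n" if "0 < q" for q :: real and m n
    using that by (simp_all add: powr_powr powr_realpow flip: powr_realpow[of "q powr A"])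
  show thesis
  proof
    show "A > 0" by fact
    show "(\<Sum>\<^sub>\<infinity>n. real (p m n) * q ^ n) \<le> real (row_sum p m) * (q powr A) ^ m" if "0 < q" "q \<le> 1" for q m
      unfolding eq row
    proof (intro sum_mono mult_left_mono)
      fix n assume "n \<in> {n. p m n \<noteq> 0}"
      then show "q ^ n \<le> (q powr A) ^ m"
        using that A(2)[of m n] unfolding pow[OF that(1)] by (intro powr_mono') auto
    qed simp
    show "real (row_sum p m) * (q powr A) ^ m \<le> (\<Sum>\<^sub>\<infinity>n. real (p m n) * q ^ n)" if "1 \<le> q" for q m
      unfolding eq row
    proof (intro sum_mono mult_left_mono)
      fix n assume "n \<in> {n. p m n \<noteq> 0}"
      moreover have "0 < q" using that by simp
      ultimately show "(q powr A) ^ m \<le> q ^ n"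
        using that A(2)[of m n] unfolding pow[OF \<open>0 < q\<close>] by (intro powr_mono) auto
    qed simp
    show "(\<lambda>n. real (p m n) * q ^ n) summable_on UNIV" for q :: real and m
      by (rule finite_support_infsum(1)[OF fin[of m]]) auto
  qed
qed

text \<open>Although \<open>xc\<close> lies on the boundary of convergence for \<open>q = 1\<close>,
  the row bound moves the effective argument to \<open>xc * q powr A < xc\<close>, where polynomial
  factors do no harm.\<close>

lemma summable_on_x_deriv:
  assumes "polygon_growth p" "conv_radius (\<lambda>m. real (row_sum p m)) = ereal xc" "0 < xc" "0 < q" "q < 1"
  shows "(\<lambda>(n, m). real (m choose k) * real (p m n) * xc ^ (m - k) * q ^ n) summable_on UNIV"
proof -
  from assms(1) obtain A where A: "A > 0"
    "\<And>m. (\<Sum>\<^sub>\<infinity>n. real (p m n) * q ^ n) \<le> real (row_sum p m) * (q powr A) ^ m"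
    "\<And>m. (\<lambda>n. real (p m n) * q ^ n) summable_on UNIV"
    by (rule infsum_row_bounds) (use assms(4,5) in simp)
  let ?R = "\<lambda>m. \<Sum>\<^sub>\<infinity>n. real (p m n) * q ^ n"
  have R: "?R m \<ge> 0" for m using assms(4) by (intro infsum_nonneg) simp
  have qA: "q powr A < 1" using assms A(1) by (simp add: powr01_less_one)
  have "summable (\<lambda>m. real m ^ k * real (row_sum p m) * (xc * q powr A) ^ m)"
    using assms qA by (intro summable_poly_row_sum[OF assms(2)]) auto
  then have s: "summable (\<lambda>m. 1 / xc ^ k * (real m ^ k * real (row_sum p m) * (xc * q powr A) ^ m))"
    by (rule summable_mult)
  have "summable (\<lambda>m. real (m choose k) * xc ^ (m - k) * ?R m)"
  proof (rule summable_comparison_test'[OF s, of 0])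
    fix m
    have "real (m choose k) * xc ^ (m - k) * ?R m \<le> real m ^ k * (xc ^ m / xc ^ k) * (real (row_sum p m) * (q powr A) ^ m)"
    proof (cases "k \<le> m")
      case True
      have "real (m choose k) \<le> real m ^ k"
        using binomial_le_power[of m k] by (simp flip: of_nat_power)
      then show ?thesis
        using assms A(2)[of m] R True by (intro mult_mono) (auto simp: power_diff)
    qed (use assms in \<open>auto simp: binomial_eq_0\<close>)
    also have "\<dots> = 1 / xc ^ k * (real m ^ k * real (row_sum p m) * (xc * q powr A) ^ m)"
      by (simp add: power_mult_distrib)
    finally show "norm (real (m choose k) * xc ^ (m - k) * ?R m) \<le> \<dots>"
      using R[of m] assms(3) by simp
  qed
  then have "summable (\<lambda>m. \<Sum>\<^sub>\<infinity>n. real (m choose k) * xc ^ (m - k) * (real (p m n) * q ^ n))"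
    by (simp add: infsum_cmult_right')
  then have "(\<lambda>(m, n). real (m choose k) * xc ^ (m - k) * (real (p m n) * q ^ n)) summable_on UNIV"
    by (intro summable_on_UNIV_nonneg_rows) (use assms A(3) in \<open>auto intro: summable_on_cmult_right\<close>)
  from summable_on_swap_UNIV[OF this] show ?thesis
    by (simp add: mult_ac)
qed

text \<open>Convergence below 1 comes from the double series. At some \<open>r > 1\<close>,
  convergence would, after exchanging the nonnegative sums, make the row-sum series converge at
  \<open>xc * r powr A\<close>, beyond its radius.\<close>

lemma conv_radius_x_deriv_coeff:
  assumes "polygon_growth p" "conv_radius (\<lambda>m. real (row_sum p m)) = ereal xc" "0 < xc"
  shows "conv_radius (x_deriv_coeff p xc k) = ereal 1"
proof (rule antisym)
  show "ereal 1 \<le> conv_radius (x_deriv_coeff p xc k)"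
  proof (rule conv_radius_geI_ex')
    fix r :: real assume r: "0 < r" "ereal r < ereal 1"
    then show "summable (\<lambda>n. x_deriv_coeff p xc k n * of_real r ^ n)"
      using summable_infsum_rows(2)[OF summable_on_x_deriv[OF assms, of r k]]
      by (simp add: x_deriv_coeff_eq_infsum[OF assms(1)] infsum_cmult_left')
  qed
  show "conv_radius (x_deriv_coeff p xc k) \<le> ereal 1"
  proof (rule conv_radius_leI_ex')
    fix r :: real assume r: "0 < r" "ereal 1 < ereal r"
    show "\<not> summable (\<lambda>n. x_deriv_coeff p xc k n * of_real r ^ n)"
    proof
      assume s: "summable (\<lambda>n. x_deriv_coeff p xc k n * of_real r ^ n)"
      from assms(1) obtain A where A: "A > 0"
        "\<And>m. real (row_sum p m) * (r powr A) ^ m \<le> (\<Sum>\<^sub>\<infinity>n. real (p m n) * r ^ n)"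
        by (rule infsum_row_bounds) (use r in auto)
      have fin: "finite {m. p m n \<noteq> 0}" for n
        using polygon_growthE[OF assms(1)] by metis
      have "(\<lambda>(n, m). real (m choose k) * real (p m n) * xc ^ (m - k) * r ^ n) summable_on UNIV"
      proof (rule summable_on_UNIV_nonneg_rows)
        show "(\<lambda>m. real (m choose k) * real (p m n) * xc ^ (m - k) * r ^ n) summable_on UNIV" for n
          by (rule finite_support_infsum(1)[OF fin[of n]]) auto
        show "summable (\<lambda>n. \<Sum>\<^sub>\<infinity>m. real (m choose k) * real (p m n) * xc ^ (m - k) * r ^ n)"
          using s by (simp add: x_deriv_coeff_eq_infsum[OF assms(1)] infsum_cmult_left')
      qed (use assms r in auto)
      from summable_infsum_rows(2)[OF summable_on_swap_UNIV[OF this]]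
      have "summable (\<lambda>m. \<Sum>\<^sub>\<infinity>n. real (m choose k) * xc ^ (m - k) * (real (p m n) * r ^ n))"
        by (simp add: mult_ac)
      \<comment> \<open>The factor \<open>xc ^ k\<close> restores \<open>xc ^ m\<close> from
        \<open>xc ^ (m - k)\<close>, which is correct once \<open>k \<le> m\<close>.\<close>
      then have "summable (\<lambda>m. xc ^ k * (real (m choose k) * xc ^ (m - k) * (\<Sum>\<^sub>\<infinity>n. real (p m n) * r ^ n)))"
        unfolding infsum_cmult_right' by (rule summable_mult)
      then have "summable (\<lambda>m. real (row_sum p m) * (xc * r powr A) ^ m)"
      proof (rule summable_comparison_test_ev[rotated])
        show "\<forall>\<^sub>F m in sequentially. norm (real (row_sum p m) * (xc * r powr A) ^ m) \<le>
            xc ^ k * (real (m choose k) * xc ^ (m - k) * (\<Sum>\<^sub>\<infinity>n. real (p m n) * r ^ n))"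
          using eventually_ge_at_top[of k]
        proof eventually_elim
          case (elim m)
          then have "1 \<le> m choose k" by (simp add: Suc_le_eq)
          then have b: "1 \<le> real (m choose k)" by simp
          have "xc ^ m * (real (row_sum p m) * (r powr A) ^ m) \<le> xc ^ m * (\<Sum>\<^sub>\<infinity>n. real (p m n) * r ^ n)"
            using assms(3) A(2) by (intro mult_left_mono) auto
          also have "\<dots> \<le> real (m choose k) * (xc ^ m * (\<Sum>\<^sub>\<infinity>n. real (p m n) * r ^ n))"
            using mult_right_mono[OF b, of "xc ^ m * (\<Sum>\<^sub>\<infinity>n. real (p m n) * r ^ n)"] assms(3) r(1)
            by (simp add: infsum_nonneg)
          also have "xc ^ m = xc ^ k * xc ^ (m - k)"
            using elim by (simp flip: power_add)
          finally show ?case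
            using assms(3) by (simp add: power_mult_distrib abs_mult mult_ac \<open>xc ^ m = xc ^ k * xc ^ (m - k)\<close>)
        qed
      qed
      moreover have "1 < r powr A" using r A(1) by simp
      then have "xc < xc * r powr A" using assms(3) by simp
      ultimately show False
        using not_summable_outside_conv_radius[of "\<lambda>m. real (row_sum p m)" "xc * r powr A"] assms(2,3) by simp
    qed
  qed simp
qed

section \<open>Derivatives of the scaling form\<close>

lemma smooth_between_DERIV:
  assumes "smooth_between s\<^sub>m s\<^sub>p \<F>" "s\<^sub>m < ereal s" "ereal s < s\<^sub>p"
  shows "((deriv ^^ j) \<F> has_field_derivative (deriv ^^ Suc j) \<F> s) (at s)"
  using assms unfolding smooth_between_def by (simp add: DERIV_deriv_iff_real_differentiable)

lemma iterated_deriv_powr: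
  fixes e a s :: real
  assumes "s > 0"
  shows "(deriv ^^ j) (\<lambda>t. a * t powr e) s = a * (\<Prod>l<j. e - real l) * s powr (e - real j)"
  using assms
proof (induction j arbitrary: s)
  case 0
  then show ?case by simp
next
  case (Suc j)
  let ?c = "a * (\<Prod>l<j. e - real l)"
  have "((\<lambda>t. ?c * t powr (e - real j)) has_field_derivative ?c * ((e - real j) * s powr (e - real j - 1))) (at s)"
    using Suc.prems by (intro DERIV_cmult has_real_derivative_powr)
  then have "((deriv ^^ j) (\<lambda>t. a * t powr e) has_field_derivative ?c * ((e - real j) * s powr (e - real j - 1))) (at s)"
    by (rule has_field_derivative_transform_within_open[where S = "{0<..}"]) (use Suc in auto)
  then show ?case
    by (simp add: DERIV_imp_deriv algebra_simps)
qed

text \<open>The operator that maps \<F> to \<open>s ^ j * (deriv ^^ j) \<F> s\<close> only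
  multiplies each power of \<open>s\<close> by a falling factorial. In this normalisation the
  remainders for all \<open>j\<close> share one gauge and can be combined linearly.\<close>

lemma asymp_expansion_remainder_tendsto:
  assumes exp: "asymp_expansion_with_derivs G \<F> a e" and pos: "\<forall>\<^sub>F s in G. s > 0"
  shows "((\<lambda>s. (s ^ j * (deriv ^^ j) \<F> s - (\<Sum>k\<le>N. a k * (\<Prod>l<j. e k - real l) * s powr e k)) / s powr e N)
            \<longlongrightarrow> 0) G"
proof -
  have "((\<lambda>s. ((deriv ^^ j) \<F> s - (\<Sum>k\<le>N. (deriv ^^ j) (\<lambda>t. a k * t powr e k) s)) / s powr (e N - real j))
      \<longlongrightarrow> 0) G"
    using exp unfolding asymp_expansion_with_derivs_def by (intro smalloD_tendsto) simp
  then show ?thesis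
  proof (rule Lim_transform_eventually)
    show "\<forall>\<^sub>F s in G. ((deriv ^^ j) \<F> s - (\<Sum>k\<le>N. (deriv ^^ j) (\<lambda>t. a k * t powr e k) s)) / s powr (e N - real j)
        = (s ^ j * (deriv ^^ j) \<F> s - (\<Sum>k\<le>N. a k * (\<Prod>l<j. e k - real l) * s powr e k)) / s powr e N"
      using pos
    proof eventually_elim
      case (elim s)
      have p: "s powr (x - real j) = s powr x / s ^ j" for x
        using elim by (simp add: powr_diff powr_realpow)
      have "(\<Sum>k\<le>N. (deriv ^^ j) (\<lambda>t. a k * t powr e k) s)
          = (\<Sum>k\<le>N. a k * (\<Prod>l<j. e k - real l) * s powr e k) / s ^ j"
        using elim by (simp add: iterated_deriv_powr p sum_divide_distrib)
      then show ?case
        using elim by (simp add: p field_simps)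
    qed
  qed
qed

text \<open>The coefficients of the \<open>j\<close>-fold derivative: with \<open>s = y / (1 - q) powr \<phi>\<close>, the \<open>j\<close>-th
  \<open>q\<close>-derivative of \<open>(1 - q) powr \<theta> * \<F> s\<close> is \<open>(1 - q) powr (\<theta> - j)\<close> times the sum over
  \<open>i \<le> j\<close> of \<open>scaling_coeff \<theta> \<phi> j i * s ^ i * (deriv ^^ i) \<F> s\<close>.\<close>

primrec scaling_coeff :: "real \<Rightarrow> real \<Rightarrow> nat \<Rightarrow> nat \<Rightarrow> real" where
  "scaling_coeff \<theta> \<phi> 0 = (\<lambda>i. if i = 0 then 1 else 0)"
| "scaling_coeff \<theta> \<phi> (Suc j) = (\<lambda>i. (real j - \<theta> + \<phi> * real i) * scaling_coeff \<theta> \<phi> j i +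
     (if i = 0 then 0 else \<phi> * scaling_coeff \<theta> \<phi> j (i - 1)))"

lemma scaling_coeff_eq_0: "j < i \<Longrightarrow> scaling_coeff \<theta> \<phi> j i = 0"
  by (induction j arbitrary: i) auto

text \<open>The recursion in dual form. \<open>E\<close> is left arbitrary because it stands once
  for \<open>s ^ i * (deriv ^^ i) \<F> s\<close> and once for falling factorials.\<close>

lemma sum_scaling_coeff_Suc:
  "(\<Sum>i\<le>Suc j. scaling_coeff \<theta> \<phi> (Suc j) i * E i) =
   (\<Sum>i\<le>j. scaling_coeff \<theta> \<phi> j i * ((real j - \<theta> + \<phi> * real i) * E i + \<phi> * E (Suc i)))"
proof -
  let ?c = "scaling_coeff \<theta> \<phi> j"
  have "(\<Sum>i\<le>Suc j. scaling_coeff \<theta> \<phi> (Suc j) i * E i) =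
     (\<Sum>i\<le>Suc j. (real j - \<theta> + \<phi> * real i) * ?c i * E i) +
     (\<Sum>i\<le>Suc j. (if i = 0 then 0 else \<phi> * ?c (i - 1)) * E i)"
    by (simp only: scaling_coeff.simps distrib_right sum.distrib)
  also have "(\<Sum>i\<le>Suc j. (real j - \<theta> + \<phi> * real i) * ?c i * E i) = (\<Sum>i\<le>j. (real j - \<theta> + \<phi> * real i) * ?c i * E i)"
    by (simp add: scaling_coeff_eq_0)
  also have "(\<Sum>i\<le>Suc j. (if i = 0 then 0 else \<phi> * ?c (i - 1)) * E i) = (\<Sum>i\<le>j. \<phi> * ?c i * E (Suc i))"
    by (simp only: sum.atMost_Suc_shift) simp
  finally show ?thesis
    by (simp add: sum.distrib[symmetric] algebra_simps)
qed

text \<open>This is the case where \<F> is the power with exponent \<open>e\<close>: the scaling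
  form is then proportional to \<open>(1 - q) powr (\<theta> - \<phi> * e)\<close>, and each
  differentiation in \<open>q\<close> contributes the next Pochhammer factor.\<close>

lemma sum_scaling_coeff_falling:
  "(\<Sum>i\<le>j. scaling_coeff \<theta> \<phi> j i * (\<Prod>l<i. e - real l)) = pochhammer (\<phi> * e - \<theta>) j"
proof (induction j)
  case 0
  then show ?case by simp
next
  case (Suc j)
  have "(\<Sum>i\<le>Suc j. scaling_coeff \<theta> \<phi> (Suc j) i * (\<Prod>l<i. e - real l)) =
     (\<Sum>i\<le>j. scaling_coeff \<theta> \<phi> j i * (\<Prod>l<i. e - real l)) * (\<phi> * e - \<theta> + real j)"
    unfolding sum_scaling_coeff_Suc sum_distrib_right by (intro sum.cong) (simp_all add: algebra_simps)
  also have "\<dots> = pochhammer (\<phi> * e - \<theta>) (Suc j)"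
    by (simp add: Suc.IH pochhammer_Suc)
  finally show ?case .
qed

lemma iterated_deriv_q_scaling_form:
  assumes smooth: "smooth_between s\<^sub>m s\<^sub>p \<F>"
    and q: "q < 1" "s\<^sub>m < ereal ((1 - x / xc) / (1 - q) powr \<phi>)" "ereal ((1 - x / xc) / (1 - q) powr \<phi>) < s\<^sub>p"
  shows "(deriv ^^ j) (\<lambda>q. scaling_form xc \<theta> \<phi> \<F> x q) q =
    (1 - q) powr (\<theta> - real j) * (\<Sum>i\<le>j. scaling_coeff \<theta> \<phi> j i *
      (((1 - x / xc) / (1 - q) powr \<phi>) ^ i * (deriv ^^ i) \<F> ((1 - x / xc) / (1 - q) powr \<phi>)))"
proof -
  define y where "y = 1 - x / xc"
  define s where "s q = y / (1 - q) powr \<phi>" for q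
  define E where "E i z = z ^ i * (deriv ^^ i) \<F> z" for i z
  \<comment> \<open>The formula must hold on an open set of \<open>q\<close>, not only at one point,
    for the next derivative to be read off from it.\<close>
  define S where "S = {q. q < 1} \<inter> (\<lambda>q. ereal (s q)) -` {s\<^sub>m<..<s\<^sub>p} "
  have "open S"
  proof -
    have "continuous_on {q. q < 1} (\<lambda>q. ereal (s q))"
      unfolding s_def by (intro continuous_intros) auto
    moreover have "open {q::real. q < 1}" by (rule open_Collect_less) (auto intro: continuous_intros)
    ultimately show ?thesis
      unfolding S_def by (intro continuous_open_preimage) auto
  qed
  have "q \<in> S" using q by (auto simp: S_def s_def y_def)
  then have "(deriv ^^ j) (\<lambda>q. scaling_form xc \<theta> \<phi> \<F> x q) q =
    (1 - q) powr (\<theta> - real j) * (\<Sum>i\<le>j. scaling_coeff \<theta> \<phi> j i * E i (s q))"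
  proof (induction j arbitrary: q)
    case 0
    then show ?case by (simp add: scaling_form_def s_def y_def E_def)
  next
    case (Suc j)
    let ?c = "scaling_coeff \<theta> \<phi> j"
    let ?R = "\<lambda>q. (1 - q) powr (\<theta> - real j) * (\<Sum>i\<le>j. ?c i * E i (s q))"
    have q: "q < 1" and sq: "s\<^sub>m < ereal (s q)" "ereal (s q) < s\<^sub>p" using Suc.prems by (auto simp: S_def)
    have E: "(E i has_field_derivative (real i * s q ^ (i - 1) * (deriv ^^ i) \<F> (s q) + s q ^ i * (deriv ^^ Suc i) \<F> (s q))) (at (s q))" for i
      unfolding E_def[abs_def]
      by (rule derivative_eq_intros smooth_between_DERIV[OF smooth sq] refl)+ simp
    have s': "(s has_field_derivative \<phi> * s q / (1 - q)) (at q)"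
      unfolding s_def[abs_def] using q
      by (auto intro!: derivative_eq_intros simp: powr_diff power2_eq_square divide_simps)
    \<comment> \<open>Because the derivative of \<open>s\<close> is
      \<open>\<phi> * s q / (1 - q)\<close>, the chain rule supplies the extra factor
      \<open>s q\<close> that turns a new derivative of \<F> into \<open>E (Suc i)\<close>. Hence
      the terms \<open>E i\<close> are closed under differentiation up to the factor
      \<open>1 / (1 - q)\<close>.\<close>
    have Es: "((\<lambda>q. E i (s q)) has_field_derivative (\<phi> * real i * E i (s q) + \<phi> * E (Suc i) (s q)) / (1 - q)) (at q)" for i
    proof -
      have "(real i * s q ^ (i - 1) * (deriv ^^ i) \<F> (s q) + s q ^ i * (deriv ^^ Suc i) \<F> (s q)) * (\<phi> * s q / (1 - q)) =
        (\<phi> * real i * E i (s q) + \<phi> * E (Suc i) (s q)) / (1 - q)"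
        by (cases i) (simp_all add: E_def algebra_simps add_divide_distrib)
      from DERIV_cong[OF DERIV_chain2[OF E s'] this] show ?thesis .
    qed
    have t: "((\<lambda>q. (1 - q) powr (\<theta> - real j)) has_field_derivative (real j - \<theta>) * (1 - q) powr (\<theta> - real (Suc j))) (at q)"
    proof -
      have "((\<lambda>q. (1 - q) powr (\<theta> - real j)) has_field_derivative
          (\<theta> - real j) * (1 - q) powr (\<theta> - real j - 1) * (0 - 1)) (at q)"
        by (rule DERIV_chain2[OF has_real_derivative_powr DERIV_diff[OF DERIV_const DERIV_ident]]) (use q in simp)
      then show ?thesis by (simp add: algebra_simps)
    qed
    have pow: "(1 - q) powr (\<theta> - real j) = (1 - q) powr (\<theta> - real (Suc j)) * (1 - q)"
      using q powr_mult_base[of "1 - q" "\<theta> - real (Suc j)"] by (simp add: algebra_simps)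
    have "(?R has_field_derivative
        (real j - \<theta>) * (1 - q) powr (\<theta> - real (Suc j)) * (\<Sum>i\<le>j. ?c i * E i (s q)) +
        (\<Sum>i\<le>j. ?c i * ((\<phi> * real i * E i (s q) + \<phi> * E (Suc i) (s q)) / (1 - q))) * (1 - q) powr (\<theta> - real j)) (at q)"
      by (intro DERIV_mult t DERIV_sum DERIV_cmult Es)
    also have "(\<Sum>i\<le>j. ?c i * ((\<phi> * real i * E i (s q) + \<phi> * E (Suc i) (s q)) / (1 - q))) * (1 - q) powr (\<theta> - real j) =
        (1 - q) powr (\<theta> - real (Suc j)) * (\<Sum>i\<le>j. ?c i * (\<phi> * real i * E i (s q) + \<phi> * E (Suc i) (s q)))"
      using q by (simp add: sum_divide_distrib[symmetric] pow)
    also have "(real j - \<theta>) * (1 - q) powr (\<theta> - real (Suc j)) * (\<Sum>i\<le>j. ?c i * E i (s q)) + \<dots> =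
        (1 - q) powr (\<theta> - real (Suc j)) * (\<Sum>i\<le>Suc j. scaling_coeff \<theta> \<phi> (Suc j) i * E i (s q))"
    proof -
      have "(\<Sum>i\<le>Suc j. scaling_coeff \<theta> \<phi> (Suc j) i * E i (s q)) =
          (\<Sum>i\<le>j. (real j - \<theta>) * (?c i * E i (s q)) + ?c i * (\<phi> * real i * E i (s q) + \<phi> * E (Suc i) (s q)))"
        by (subst sum_scaling_coeff_Suc) (intro sum.cong refl, simp add: algebra_simps)
      also have "\<dots> = (real j - \<theta>) * (\<Sum>i\<le>j. ?c i * E i (s q)) +
          (\<Sum>i\<le>j. ?c i * (\<phi> * real i * E i (s q) + \<phi> * E (Suc i) (s q)))"
        by (simp only: sum.distrib sum_distrib_left)
      finally show ?thesis by (simp only: distrib_left mult_ac)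
    qed
    finally have "((deriv ^^ j) (\<lambda>q. scaling_form xc \<theta> \<phi> \<F> x q) has_field_derivative \<dots>) (at q)"
      by (rule has_field_derivative_transform_within_open[OF _ \<open>open S\<close> Suc.prems]) (simp add: Suc.IH)
    then show ?case
      by (simp add: DERIV_imp_deriv)
  qed
  then show ?thesis by (simp add: E_def s_def y_def)
qed

text \<open>The scaling variable is affine in \<open>x\<close>, so every differentiation contributes
  the same constant factor and no combinatorial coefficients appear.\<close>

lemma iterated_deriv_x_scaling_form:
  assumes smooth: "smooth_between s\<^sub>m s\<^sub>p \<F>" and xc: "xc > 0"
    and x: "s\<^sub>m < ereal ((1 - x / xc) / (1 - q) powr \<phi>)" "ereal ((1 - x / xc) / (1 - q) powr \<phi>) < s\<^sub>p"
  shows "(deriv ^^ j) (\<lambda>x. scaling_form xc \<theta> \<phi> \<F> x q) x =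
    (1 - q) powr \<theta> * (- 1 / (xc * (1 - q) powr \<phi>)) ^ j * (deriv ^^ j) \<F> ((1 - x / xc) / (1 - q) powr \<phi>)"
proof -
  define s where "s x = (1 - x / xc) / (1 - q) powr \<phi>" for x
  define b where "b = - 1 / (xc * (1 - q) powr \<phi>)"
  define S where "S = (\<lambda>x. ereal (s x)) -` {s\<^sub>m<..<s\<^sub>p}"
  have "open S"
  proof -
    have "continuous_on UNIV (\<lambda>x. ereal (s x))"
      unfolding s_def divide_inverse by (intro continuous_intros)
    then show ?thesis
      unfolding S_def by (intro open_vimage) auto
  qed
  have s': "(s has_field_derivative b) (at x)" for x
  proof -
    have "((\<lambda>x. (1 - x / xc) / (1 - q) powr \<phi>) has_field_derivative (0 - 1 / xc) / (1 - q) powr \<phi>) (at x)"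
      by (intro DERIV_cdivide DERIV_diff DERIV_const DERIV_ident)
    then show ?thesis by (simp add: s_def[abs_def] b_def)
  qed
  have "x \<in> S" using x by (auto simp: S_def s_def)
  then have "(deriv ^^ j) (\<lambda>x. scaling_form xc \<theta> \<phi> \<F> x q) x = (1 - q) powr \<theta> * b ^ j * (deriv ^^ j) \<F> (s x)"
  proof (induction j arbitrary: x)
    case 0
    then show ?case by (simp add: scaling_form_def s_def)
  next
    case (Suc j)
    have sx: "s\<^sub>m < ereal (s x)" "ereal (s x) < s\<^sub>p" using Suc.prems by (auto simp: S_def)
    have "((\<lambda>x. (1 - q) powr \<theta> * b ^ j * (deriv ^^ j) \<F> (s x)) has_field_derivative
        (1 - q) powr \<theta> * b ^ j * ((deriv ^^ Suc j) \<F> (s x) * b)) (at x)"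
      by (intro DERIV_cmult DERIV_chain2[OF smooth_between_DERIV[OF smooth sx] s'])
    then have "((deriv ^^ j) (\<lambda>x. scaling_form xc \<theta> \<phi> \<F> x q) has_field_derivative
        (1 - q) powr \<theta> * b ^ j * ((deriv ^^ Suc j) \<F> (s x) * b)) (at x)"
      by (rule has_field_derivative_transform_within_open[OF _ \<open>open S\<close> Suc.prems]) (simp add: Suc.IH)
    then show ?case
      by (simp add: DERIV_imp_deriv algebra_simps)
  qed
  then show ?thesis by (simp add: b_def s_def)
qed

section \<open>Leading terms of the differentiated expansions\<close>

text \<open>The hypothesis on the exponents below \<open>k\<close> makes their Pochhammer factors vanish, so that
  only the term with index \<open>k\<close> survives.\<close>

lemma tendsto_scaling_coeff_expansion:
  assumes exp: "asymp_expansion_with_derivs G \<F> a e" and pos: "\<forall>\<^sub>F s in G. s > 0"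
    and e: "\<And>l. l < k \<Longrightarrow> \<phi> * e l - \<theta> = - real l"
  shows "((\<lambda>s. (\<Sum>i\<le>k. scaling_coeff \<theta> \<phi> k i * (s ^ i * (deriv ^^ i) \<F> s)) / s powr e k)
    \<longlongrightarrow> a k * pochhammer (\<phi> * e k - \<theta>) k) G"
proof -
  let ?c = "scaling_coeff \<theta> \<phi> k" and ?ff = "\<lambda>e i. \<Prod>l<i. e - real l"
  let ?P = "\<lambda>s i. \<Sum>l\<le>k. a l * ?ff (e l) i * s powr e l"
  have "((\<lambda>s. (\<Sum>i\<le>k. ?c i * ((s ^ i * (deriv ^^ i) \<F> s - ?P s i) / s powr e k)) + a k * pochhammer (\<phi> * e k - \<theta>) k)
      \<longlongrightarrow> (\<Sum>i\<le>k. ?c i * 0) + a k * pochhammer (\<phi> * e k - \<theta>) k) G"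
    by (intro tendsto_add tendsto_const tendsto_sum tendsto_mult_left asymp_expansion_remainder_tendsto[OF exp pos])
  then have "((\<lambda>s. (\<Sum>i\<le>k. ?c i * ((s ^ i * (deriv ^^ i) \<F> s - ?P s i) / s powr e k)) + a k * pochhammer (\<phi> * e k - \<theta>) k)
      \<longlongrightarrow> a k * pochhammer (\<phi> * e k - \<theta>) k) G"
    by (simp only: mult_zero_right sum.neutral_const add_0)
  then show ?thesis
  proof (rule Lim_transform_eventually[OF _ eventually_mono[OF pos]])
    fix s :: real assume s: "s > 0"
    have "(\<Sum>i\<le>k. ?c i * ?P s i) = (\<Sum>l\<le>k. a l * s powr e l * (\<Sum>i\<le>k. ?c i * ?ff (e l) i))"
      unfolding sum_distrib_left by (subst sum.swap) (simp add: mult_ac)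
    also have "\<dots> = (\<Sum>l\<le>k. a l * s powr e l * pochhammer (\<phi> * e l - \<theta>) k)"
      by (simp add: sum_scaling_coeff_falling)
    also have "\<dots> = (\<Sum>l\<in>{k}. a l * s powr e l * pochhammer (\<phi> * e l - \<theta>) k)"
      by (rule sum.mono_neutral_right) (auto simp: e pochhammer_of_nat_eq_0_lemma)
    finally have "(\<Sum>i\<le>k. ?c i * ?P s i) / s powr e k = a k * pochhammer (\<phi> * e k - \<theta>) k"
      using s by simp
    moreover have split: "(\<Sum>i\<le>k. ?c i * ((A i - P i) / z)) = (\<Sum>i\<le>k. ?c i * A i) / z - (\<Sum>i\<le>k. ?c i * P i) / z"
      for A P :: "nat \<Rightarrow> real" and z
      by (simp add: right_diff_distrib diff_divide_distrib sum_subtractf sum_divide_distrib)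
    ultimately show "(\<Sum>i\<le>k. ?c i * ((s ^ i * (deriv ^^ i) \<F> s - ?P s i) / s powr e k)) + a k * pochhammer (\<phi> * e k - \<theta>) k
        = (\<Sum>i\<le>k. ?c i * (s ^ i * (deriv ^^ i) \<F> s)) / s powr e k"
      unfolding split by simp
  qed
qed

text \<open>The lower terms are monomials of degree less than \<open>k\<close>, so their falling
  factorials contain a zero factor and only the term with index \<open>k\<close> remains.\<close>

lemma tendsto_derivative_expansion:
  assumes exp: "asymp_expansion_with_derivs G \<F> a e" and pos: "\<forall>\<^sub>F s in G. s > 0"
    and e: "\<And>l. l < k \<Longrightarrow> e l = real l"
  shows "((\<lambda>s. s ^ k * (deriv ^^ k) \<F> s / s powr e k) \<longlongrightarrow> a k * (\<Prod>l<k. e k - real l)) G"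
proof -
  let ?ff = "\<lambda>e. \<Prod>l<k. e - real l"
  have "((\<lambda>s. (s ^ k * (deriv ^^ k) \<F> s - (\<Sum>l\<le>k. a l * ?ff (e l) * s powr e l)) / s powr e k + a k * ?ff (e k))
      \<longlongrightarrow> 0 + a k * ?ff (e k)) G"
    by (intro tendsto_add tendsto_const asymp_expansion_remainder_tendsto[OF exp pos])
  then have "((\<lambda>s. (s ^ k * (deriv ^^ k) \<F> s - (\<Sum>l\<le>k. a l * ?ff (e l) * s powr e l)) / s powr e k + a k * ?ff (e k))
      \<longlongrightarrow> a k * ?ff (e k)) G"
    by (simp only: add_0)
  then show ?thesis
  proof (rule Lim_transform_eventually[OF _ eventually_mono[OF pos]])
    fix s :: real assume s: "s > 0"
    have "(\<Sum>l\<le>k. a l * ?ff (e l) * s powr e l) = (\<Sum>l\<in>{k}. a l * ?ff (e l) * s powr e l)"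
      by (rule sum.mono_neutral_right) (auto simp: e)
    then show "(s ^ k * (deriv ^^ k) \<F> s - (\<Sum>l\<le>k. a l * ?ff (e l) * s powr e l)) / s powr e k + a k * ?ff (e k)
        = s ^ k * (deriv ^^ k) \<F> s / s powr e k"
      using s by (simp add: diff_divide_distrib)
  qed
qed

section \<open>Comparison of exponents\<close>

lemma sing_asymp_equiv_cong:
  assumes "\<forall>\<^sub>F x in at_left \<rho>. r x = r' x"
  shows "sing_asymp_equiv a \<rho> r \<longleftrightarrow> sing_asymp_equiv a \<rho> r'"
proof -
  have "g \<sim>[at_left \<rho>] r \<longleftrightarrow> g \<sim>[at_left \<rho>] r'" for g
    by (rule asymp_equiv_cong) (use assms in auto)
  then show ?thesis by (simp add: sing_asymp_equiv_def)
qed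

text \<open>Common to both cases: \<open>x\<close> is the outer variable with critical value \<rho>,
  \<open>q\<close> the inner one with critical value \<open>r\<close>. The inner limit of the
  \<open>k\<close>-th derivative is \<open>fact k\<close> times a difference of two power series in
  \<open>x\<close>, with radii \<rho> and larger than \<rho>, so it cannot vanish near
  \<rho>.\<close>

lemma sing_asymp_equiv_of_close_derivs:
  fixes a c :: "nat \<Rightarrow> nat \<Rightarrow> real" and f g :: "real \<Rightarrow> real \<Rightarrow> real"
  assumes pos: "0 < \<rho>" "0 < r"
    and a: "\<And>x j. 0 < x \<Longrightarrow> x < \<rho> \<Longrightarrow>
      (\<lambda>(m, n). real (n choose j) * a m n * r ^ (n - j) * x ^ m) summable_on UNIV"
    and \<alpha>: "conv_radius \<alpha> = ereal \<rho>" "\<And>m. \<alpha> m = (\<Sum>\<^sub>\<infinity>n. real (n choose k) * a m n * r ^ (n - k))"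
    and c: "\<rho> < x1" "r < r1" "\<And>x q. \<bar>x\<bar> < x1 \<Longrightarrow> \<bar>q\<bar> < r1 \<Longrightarrow> gf_converges c x q"
    and f: "\<And>x q. 0 < x \<Longrightarrow> x < \<rho> \<Longrightarrow> 0 < q \<Longrightarrow> q < r \<Longrightarrow> f x q = gf a x q - gf c x q"
    and close: "\<And>\<epsilon>. \<epsilon> > 0 \<Longrightarrow>
      \<forall>\<^sub>F x in at_left \<rho>. \<forall>\<^sub>F q in at_left r. \<bar>(deriv ^^ k) (f x) q - g x q\<bar> \<le> \<epsilon> * \<bar>g x q\<bar>"
    and g: "\<forall>\<^sub>F x in at_left \<rho>. ((\<lambda>q. g x q / \<tau> q powr d) \<longlongrightarrow> M x) (at_left r)"
    and M: "\<forall>\<^sub>F x in at_left \<rho>. M x \<noteq> 0"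
    and \<tau>: "filterlim \<tau> (at_right 0) (at_left r)"
  shows "d = 0" and "sing_asymp_equiv \<alpha> \<rho> (\<lambda>x. M x / fact k)"
proof -
  \<comment> \<open>These are the coefficients of the regular part required by
    \<open>sing_asymp_equiv\<close>: the \<open>k\<close>-th inner derivative at \<open>r\<close> of
    the series of \<open>c\<close>, divided by \<open>fact k\<close>.\<close>
  define b where "b m = (\<Sum>\<^sub>\<infinity>n. real (n choose k) * c m n * r ^ (n - k))" for m
  have cconv: "gf_converges c x r" if "0 < x" "x < x1" for x
    using c(3)[of x r] that pos c(2) by simp
  have ck: "(\<lambda>(m, n). real (n choose k) * c m n * r ^ (n - k) * x ^ m) summable_on UNIV" if "0 < x" "x < x1" for x
    \<comment> \<open>Any inner value strictly between \<open>r\<close> and \<open>r1\<close> would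
      do; the midpoint leaves the room needed for differentiation at \<open>r\<close>.\<close>
    using gf_converges_deriv[of c x "(r + r1) / 2" r k] c(3)[of x "(r + r1) / 2"] that pos c(2) by simp
  have aconv: "gf_converges a x r" if "0 < x" "x < \<rho>" for x
    using a[OF that, of 0] by (simp add: gf_converges_def mult_ac)
  have b: "conv_radius b > ereal \<rho>"
  proof -
    define x where "x = (\<rho> + x1) / 2"
    have x: "0 < x" "\<rho> < x" "x < x1" using pos c(1) by (auto simp: x_def)
    have "summable (\<lambda>m. b m * x ^ m)"
      using summable_infsum_rows(2)[OF ck[OF x(1,3)]] by (simp add: b_def infsum_cmult_left')
    then have "ereal x \<le> conv_radius b"
      using conv_radius_geI[of b x] x by simp
    then show ?thesis
      using x(2) by (meson ereal_less_ereal_Ex less_le_trans less_ereal.simps(1))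
  qed
  define L where "L x = fact k * ((\<Sum>m. \<alpha> m * x ^ m) - (\<Sum>m. b m * x ^ m))" for x
  have lim: "((deriv ^^ k) (f x) \<longlongrightarrow> L x) (at_left r)" if x: "0 < x" "x < \<rho>" for x
  proof -
    let ?u = "\<lambda>m n. a m n - c m n"
    let ?K = "\<lambda>u m n. real (n choose k) * u m n * r ^ (n - k) * x ^ m"
    have x1: "x < x1" using x c(1) by simp
    have Keq: "(\<lambda>(m, n). ?K ?u m n) = (\<lambda>z. (case z of (m, n) \<Rightarrow> ?K a m n) - (case z of (m, n) \<Rightarrow> ?K c m n))"
      by (auto simp: algebra_simps)
    have Ks: "(\<lambda>(m, n). ?K ?u m n) summable_on UNIV"
      unfolding Keq using a[OF x, of k] ck[OF x(1) x1] by (rule infsum_diff_real(1))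
    have "((deriv ^^ k) (f x) \<longlongrightarrow>
        fact k * (\<Sum>m. (\<Sum>\<^sub>\<infinity>n. real (n choose k) * ?u m n * r ^ (n - k)) * x ^ m)) (at_left r)"
    proof (rule tendsto_iterated_deriv_gf(2)[OF pos(2) _ Ks])
      show "gf_converges ?u x r"
        by (rule gf_diff(1)[OF aconv[OF x] cconv[OF x(1) x1]])
      show "f x q = gf ?u x q" if "0 < q" "q < r" for q
        using f[OF x that] gf_diff(2)[of a x q c] gf_converges_mono[OF aconv[OF x], of q]
          gf_converges_mono[OF cconv[OF x(1) x1], of q] that by simp
    qed
    also have "(\<Sum>m. (\<Sum>\<^sub>\<infinity>n. real (n choose k) * ?u m n * r ^ (n - k)) * x ^ m) = (\<Sum>\<^sub>\<infinity>(m, n). ?K ?u m n)"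
      using summable_infsum_rows(3)[OF Ks] by (simp add: infsum_cmult_left')
    also have "\<dots> = (\<Sum>\<^sub>\<infinity>(m, n). ?K a m n) - (\<Sum>\<^sub>\<infinity>(m, n). ?K c m n)"
      unfolding Keq using a[OF x, of k] ck[OF x(1) x1] by (rule infsum_diff_real(2))
    also have "(\<Sum>\<^sub>\<infinity>(m, n). ?K a m n) = (\<Sum>m. \<alpha> m * x ^ m)"
      using summable_infsum_rows(3)[OF a[OF x, of k]] by (simp add: infsum_cmult_left' \<alpha>(2))
    also have "(\<Sum>\<^sub>\<infinity>(m, n). ?K c m n) = (\<Sum>m. b m * x ^ m)"
      using summable_infsum_rows(3)[OF ck[OF x(1) x1]] by (simp add: infsum_cmult_left' b_def)
    finally show ?thesis unfolding L_def .
  qed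
  have inner: "\<forall>\<^sub>F x in at_left \<rho>. ((deriv ^^ k) (f x) \<longlongrightarrow> L x) (at_left r)"
    using eventually_at_left_real[OF pos(1)] by eventually_elim (use lim in simp)
  have L: "\<not> (\<forall>\<^sub>F x in at_left \<rho>. L x = 0)"
    using powser_not_eventually_eq[OF pos(1) \<alpha>(1) b] by (simp add: L_def)
  note res = exponent_zero_and_asymp_equiv[OF close inner g M \<tau> _ _ L]
  show "d = 0" by (rule res(1)) auto
  have "L \<sim>[at_left \<rho>] M" by (rule res(2)) auto
  then have "(\<lambda>x. L x / fact k) \<sim>[at_left \<rho>] (\<lambda>x. M x / fact k)"
    by (intro asymp_equiv_intros)
  then show "sing_asymp_equiv \<alpha> \<rho> (\<lambda>x. M x / fact k)"
    unfolding sing_asymp_equiv_def using \<alpha>(1) b by (auto simp: L_def)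
qed

text \<open>The sign produced here cancels the alternating sign of the expansion coefficients in the
  first case.\<close>

lemma pochhammer_uminus_of_nat: "pochhammer (- real k) k = (- 1) ^ k * fact k"
  using pochhammer_minus[of "real k" k] by (simp add: pochhammer_fact)

lemma filterlim_diff_at_left: "filterlim (\<lambda>q. b - q) (at_right 0) (at_left (b::real))"
proof (subst filterlim_at, intro conjI)
  have "((\<lambda>q. b - q) \<longlongrightarrow> b - b) (at_left b)" by (intro tendsto_intros)
  then show "((\<lambda>q. b - q) \<longlongrightarrow> 0) (at_left b)" by simp
  show "\<forall>\<^sub>F q in at_left b. b - q \<in> {0<..} \<and> b - q \<noteq> 0"
    by (auto simp: eventually_at_filter)
qed

text \<open>One step of a strong induction on \<open>k\<close>: \<open>prev\<close> fixes the
  earlier exponents, so the \<open>k\<close>-th derivative exposes the term of index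
  \<open>k\<close>, whose exponent is then forced.\<close>

lemma q_derivative_step:
  fixes \<F> :: "real \<Rightarrow> real" and f \<gamma> :: "nat \<Rightarrow> real"
  assumes growth: "polygon_growth p"
    and xc: "0 < xc" "conv_radius (\<lambda>m. real (row_sum p m)) = ereal xc"
    and phi: "\<phi> > 0"
    and interval: "s\<^sub>m < \<infinity>"
    and c: "xc < x1" "1 < q1" "\<And>x q. \<bar>x\<bar> < x1 \<Longrightarrow> \<bar>q\<bar> < q1 \<Longrightarrow> gf_converges c x q"
    and valid: "scaling_valid_q_derivs p c xc \<theta> \<phi> s\<^sub>m \<infinity> \<F>"
    and smooth: "smooth_between s\<^sub>m \<infinity> \<F>"
    and f: "f k \<noteq> 0" and \<gamma>: "strict_mono \<gamma>"
    and exp: "asymp_expansion_with_derivs at_top \<F> (\<lambda>k. (- 1) ^ k * f k) (\<lambda>k. - \<gamma> k)"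
    and prev: "\<And>l. l < k \<Longrightarrow> \<theta> + \<phi> * \<gamma> l = real l"
  shows "\<theta> + \<phi> * \<gamma> k = real k"
    and "sing_asymp_equiv (q_deriv_coeff p k) xc (\<lambda>x. f k / (1 - x / xc) powr \<gamma> k)"
proof -
  let ?s = "\<lambda>x q. (1 - x / xc) / (1 - q) powr \<phi>"
  let ?g = "\<lambda>x q. (deriv ^^ k) (\<lambda>q. scaling_form xc \<theta> \<phi> \<F> x q) q"
  define \<delta> where "\<delta> = \<theta> + \<phi> * \<gamma> k"
  define C where "C = (- 1) ^ k * f k * pochhammer (- \<delta>) k"
  let ?M = "\<lambda>x. (1 - x / xc) powr (- \<gamma> k) * C"
  let ?W = "\<lambda>s. (\<Sum>i\<le>k. scaling_coeff \<theta> \<phi> k i * (s ^ i * (deriv ^^ i) \<F> s))"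
  have near: "\<forall>\<^sub>F x in at_left xc. 0 < x \<and> x < xc"
    using eventually_at_left_real[OF xc(1)] by simp
  have near1: "\<forall>\<^sub>F q in at_left (1::real). 0 < q \<and> q < 1"
    using eventually_at_left_real[of 0 "1::real"] by simp
  note \<tau> = filterlim_diff_at_left[of 1]
  have s_top: "filterlim (?s x) at_top (at_left 1)" if "0 < x" "x < xc" for x
  proof (rule LIM_at_top_divide)
    show "0 < 1 - x / xc" using that xc(1) by simp
    show "((\<lambda>q. (1 - q) powr \<phi>) \<longlongrightarrow> 0) (at_left 1)"
      using \<tau> near1 phi
      by (intro tendsto_zero_powrI[OF _ tendsto_const _ phi]) (auto simp: filterlim_at elim: eventually_mono)
    show "\<forall>\<^sub>F q in at_left 1. 0 < (1 - q) powr \<phi>"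
      using near1 by eventually_elim simp
  qed simp
  have s_gt: "\<forall>\<^sub>F q in at_left 1. s\<^sub>m < ereal (?s x q)" if "0 < x" "x < xc" for x
  proof (cases s\<^sub>m)
    case (real r)
    then show ?thesis
      using filterlim_at_top_dense[THEN iffD1, OF s_top[OF that]] by simp
  qed (use interval in auto)
  \<comment> \<open>For fixed \<open>x < xc\<close> the scaling variable grows without bound as
    \<open>q\<close> tends to 1, so the upper end of the interval has to be infinite for the path to
    stay in the domain.\<close>
  have dom: "\<forall>\<^sub>F x in at_left xc. \<forall>\<^sub>F q in at_left 1. (x, q) \<in> scaling_domain xc \<phi> s\<^sub>m \<infinity>"
    using near
  proof eventually_elim
    case (elim x)
    from near1 s_gt[of x] elim show ?case
      unfolding scaling_domain_def by (auto elim: eventually_elim2)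
  qed
  have close: "\<forall>\<^sub>F x in at_left xc. \<forall>\<^sub>F q in at_left 1.
      \<bar>(deriv ^^ k) (\<lambda>q. gf_sing p c x q) q - ?g x q\<bar> \<le> \<epsilon> * \<bar>?g x q\<bar>" if "\<epsilon> > 0" for \<epsilon>
    using eventually_at_within_Times_at_left(1)[OF asymp_equiv_imp_eventually_close[OF
        valid[unfolded scaling_valid_q_derivs_def, rule_format, of k] that] dom] by simp
  have W: "((\<lambda>s. ?W s / s powr (- \<gamma> k)) \<longlongrightarrow> C) at_top"
  proof -
    have "\<phi> * - \<gamma> k - \<theta> = - \<delta>" by (simp add: \<delta>_def)
    moreover have "\<phi> * - \<gamma> l - \<theta> = - real l" if "l < k" for l
      using prev[OF that] by simp
    ultimately show ?thesis
      using tendsto_scaling_coeff_expansion[OF exp eventually_gt_at_top, of k \<phi> \<theta>]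
      by (simp only: C_def)
  qed
  \<comment> \<open>The exponent collects \<open>\<theta> - k\<close> from differentiation and
    \<open>\<phi> * \<gamma> k\<close> from the power of the scaling variable; the remaining factor
    depends on \<open>x\<close> alone.\<close>
  have glim: "\<forall>\<^sub>F x in at_left xc. ((\<lambda>q. ?g x q / (1 - q) powr (\<delta> - real k)) \<longlongrightarrow> ?M x) (at_left 1)"
    using near
  proof eventually_elim
    case (elim x)
    then have x: "0 < x" "x < xc" by auto
    then have y: "0 < 1 - x / xc" using xc(1) by simp
    have "((\<lambda>q. (1 - x / xc) powr (- \<gamma> k) * (?W (?s x q) / ?s x q powr (- \<gamma> k))) \<longlongrightarrow> ?M x) (at_left 1)"
      by (intro tendsto_mult_left filterlim_compose[OF W s_top[OF x]])
    then show ?case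
    proof (rule Lim_transform_eventually)
      show "\<forall>\<^sub>F q in at_left 1. (1 - x / xc) powr (- \<gamma> k) * (?W (?s x q) / ?s x q powr (- \<gamma> k)) =
          ?g x q / (1 - q) powr (\<delta> - real k)"
        using near1 s_gt[OF x]
      proof eventually_elim
        case (elim q)
        then have q: "0 < 1 - q" by simp
        have "?g x q = (1 - q) powr (\<theta> - real k) * ?W (?s x q)"
          using elim by (intro iterated_deriv_q_scaling_form[OF smooth]) auto
        moreover have "?s x q powr (- \<gamma> k) = (1 - x / xc) powr (- \<gamma> k) * (1 - q) powr (\<phi> * \<gamma> k)"
          using q y by (simp add: powr_divide powr_powr powr_minus divide_simps)
        moreover have "(1 - q) powr (\<delta> - real k) = (1 - q) powr (\<theta> - real k) * (1 - q) powr (\<phi> * \<gamma> k)"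
          unfolding \<delta>_def by (simp add: algebra_simps flip: powr_add)
        ultimately show ?case using q y x xc(1) by simp
      qed
    qed
  qed
  \<comment> \<open>The Pochhammer factor vanishes only if \<delta> is one of 0, ...,
    \<open>k - 1\<close>. These are the values taken at the earlier exponents, and \<delta> exceeds
    them because \<gamma> is strictly increasing and \<phi> is positive.\<close>
  have C: "C \<noteq> 0"
  proof -
    have "\<delta> \<noteq> real l" if l: "l < k" for l
    proof -
      have "\<gamma> l < \<gamma> k" using \<gamma> l by (simp add: strict_mono_less)
      then have "\<theta> + \<phi> * \<gamma> l < \<delta>" unfolding \<delta>_def using phi by simp
      then show ?thesis using prev[OF l] by simp
    qed
    then show ?thesis
      using f by (auto simp: C_def pochhammer_eq_0_iff)
  qed
  have M: "\<forall>\<^sub>F x in at_left xc. ?M x \<noteq> 0"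
    using near by eventually_elim (use C xc(1) in auto)
  note core = sing_asymp_equiv_of_close_derivs[where a = "\<lambda>m n. real (p m n)" and k = k,
      OF xc(1) zero_less_one summable_on_q_deriv[OF growth xc(2)]
        conv_radius_q_deriv_coeff[OF growth xc(2,1)] q_deriv_coeff_eq_infsum[OF growth] c gf_sing_def close glim M \<tau>]
  have "\<delta> - real k = 0" by (rule core(1))
  then have \<delta>: "\<delta> = real k" by simp
  then show "\<theta> + \<phi> * \<gamma> k = real k" by (simp add: \<delta>_def)
  have "?M x / fact k = f k / (1 - x / xc) powr \<gamma> k" for x
    unfolding C_def \<delta> pochhammer_uminus_of_nat
    by (simp add: powr_minus divide_simps flip: power_mult_distrib)
  then show "sing_asymp_equiv (q_deriv_coeff p k) xc (\<lambda>x. f k / (1 - x / xc) powr \<gamma> k)"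
    using core(2) by simp
qed

text \<open>The counterpart with \<open>q\<close> as the outer variable: for fixed
  \<open>q < 1\<close> the scaling variable tends to 0 from the right as \<open>x\<close> tends to
  \<open>xc\<close> from the left.\<close>

lemma x_derivative_step:
  fixes \<F> :: "real \<Rightarrow> real" and h \<alpha> :: "nat \<Rightarrow> real"
  assumes growth: "polygon_growth p"
    and xc: "0 < xc" "conv_radius (\<lambda>m. real (row_sum p m)) = ereal xc"
    and interval: "s\<^sub>m \<le> 0" "0 < s\<^sub>p"
    and c: "xc < x1" "1 < q1" "\<And>x q. \<bar>x\<bar> < x1 \<Longrightarrow> \<bar>q\<bar> < q1 \<Longrightarrow> gf_converges c x q"
    and valid: "scaling_valid_x_derivs p c xc \<theta> \<phi> s\<^sub>m s\<^sub>p \<F>"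
    and smooth: "smooth_between s\<^sub>m s\<^sub>p \<F>"
    and h: "h k \<noteq> 0" and \<alpha>: "strict_mono \<alpha>"
    and exp: "asymp_expansion_with_derivs (at_right 0) \<F> (\<lambda>k. (- 1) ^ k * h k) \<alpha>"
    and prev: "\<And>l. l < k \<Longrightarrow> \<alpha> l = real l"
  shows "\<alpha> k = real k"
    and "sing_asymp_equiv (x_deriv_coeff p xc k) 1 (\<lambda>q. (1 / xc ^ k) * h k / (1 - q) powr (real k * \<phi> - \<theta>))"
proof -
  let ?s = "\<lambda>q x. (1 - x / xc) / (1 - q) powr \<phi>"
  let ?g = "\<lambda>q x. (deriv ^^ k) (\<lambda>x. scaling_form xc \<theta> \<phi> \<F> x q) x"
  let ?b = "\<lambda>q. - 1 / (xc * (1 - q) powr \<phi>)"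
  define C where "C = (- 1) ^ k * h k * (\<Prod>l<k. \<alpha> k - real l)"
  \<comment> \<open>The last power is what remains of the scaling variable after its numerator
    \<open>1 - x / xc\<close> is split off; it equals 1 as soon as \<open>\<alpha> k = k\<close> is
    known.\<close>
  let ?M = "\<lambda>q. (1 - q) powr \<theta> * ?b q ^ k * (C * (1 / (1 - q) powr \<phi>) powr (\<alpha> k - real k))"
  have near: "\<forall>\<^sub>F x in at_left xc. 0 < x \<and> x < xc"
    using eventually_at_left_real[OF xc(1)] by simp
  have near1: "\<forall>\<^sub>F q in at_left (1::real). 0 < q \<and> q < 1"
    using eventually_at_left_real[of 0 "1::real"] by simp
  \<comment> \<open>Two values of \<open>z\<close> are used: 1 for the small parameter \<tau>, and
    \<open>(1 - q) powr \<phi>\<close> for the scaling variable.\<close>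
  have s_right: "filterlim (\<lambda>x. (1 - x / xc) / z) (at_right 0) (at_left xc)" if "0 < z" for z
  proof (subst filterlim_at, intro conjI)
    have "((\<lambda>x. (1 - x / xc) / z) \<longlongrightarrow> (1 - xc / xc) / z) (at_left xc)"
      using that xc(1) by (intro tendsto_intros) auto
    then show "((\<lambda>x. (1 - x / xc) / z) \<longlongrightarrow> 0) (at_left xc)" using xc(1) by simp
    show "\<forall>\<^sub>F x in at_left xc. (1 - x / xc) / z \<in> {0<..} \<and> (1 - x / xc) / z \<noteq> 0"
      using near by eventually_elim (use that xc(1) in auto)
  qed
  note \<tau> = s_right[OF zero_less_one, unfolded div_by_1]
  have s_in: "\<forall>\<^sub>F x in at_left xc. s\<^sub>m < ereal (?s q x) \<and> ereal (?s q x) < s\<^sub>p" if "q < 1" for q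
  proof -
    have "filterlim (?s q) (at_right 0) (at_left xc)"
      using that by (intro s_right) simp
    then have s0: "(?s q \<longlongrightarrow> 0) (at_left xc)" and spos: "\<forall>\<^sub>F x in at_left xc. 0 < ?s q x"
      by (simp_all add: filterlim_at eventually_conj_iff)
    have "((\<lambda>x. ereal (?s q x)) \<longlongrightarrow> ereal 0) (at_left xc)"
      using s0 by (rule tendsto_ereal)
    then have "\<forall>\<^sub>F x in at_left xc. ereal (?s q x) < s\<^sub>p"
      by (rule order_tendstoD(2)) (use interval(2) in \<open>simp add: zero_ereal_def\<close>)
    with spos show ?thesis
    proof eventually_elim
      case (elim x)
      have "s\<^sub>m < ereal (?s q x)"
        using interval(1) elim(1) by (metis ereal_less(2) le_less_trans)
      then show ?case using elim(2) by simp
    qed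
  qed
  have dom: "\<forall>\<^sub>F q in at_left 1. \<forall>\<^sub>F x in at_left xc. (x, q) \<in> scaling_domain xc \<phi> s\<^sub>m s\<^sub>p"
    using near1
  proof eventually_elim
    case (elim q)
    from near s_in[of q] elim show ?case
      unfolding scaling_domain_def by (auto elim: eventually_elim2)
  qed
  have close: "\<forall>\<^sub>F q in at_left 1. \<forall>\<^sub>F x in at_left xc.
      \<bar>(deriv ^^ k) (\<lambda>x. gf_sing p c x q) x - ?g q x\<bar> \<le> \<epsilon> * \<bar>?g q x\<bar>" if "\<epsilon> > 0" for \<epsilon>
    using eventually_at_within_Times_at_left(2)[OF asymp_equiv_imp_eventually_close[OF
        valid[unfolded scaling_valid_x_derivs_def, rule_format, of k] that] dom] by simp
  have W: "((\<lambda>s. s ^ k * (deriv ^^ k) \<F> s / s powr \<alpha> k) \<longlongrightarrow> C) (at_right 0)"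
    unfolding C_def
    by (rule tendsto_derivative_expansion[OF exp eventually_at_right_less prev])
  have glim: "\<forall>\<^sub>F q in at_left 1. ((\<lambda>x. ?g q x / (1 - x / xc) powr (\<alpha> k - real k)) \<longlongrightarrow> ?M q) (at_left xc)"
    using near1
  proof eventually_elim
    case (elim q)
    then have q: "q < 1" by simp
    have "((\<lambda>x. (1 - q) powr \<theta> * ?b q ^ k * ((?s q x ^ k * (deriv ^^ k) \<F> (?s q x) / ?s q x powr \<alpha> k) *
          (1 / (1 - q) powr \<phi>) powr (\<alpha> k - real k))) \<longlongrightarrow> ?M q) (at_left xc)"
      using q by (intro tendsto_mult_left tendsto_mult_right filterlim_compose[OF W s_right]) simp
    then show ?case
    proof (rule Lim_transform_eventually)
      show "\<forall>\<^sub>F x in at_left xc. (1 - q) powr \<theta> * ?b q ^ k * ((?s q x ^ k * (deriv ^^ k) \<F> (?s q x) / ?s q x powr \<alpha> k) *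
          (1 / (1 - q) powr \<phi>) powr (\<alpha> k - real k)) = ?g q x / (1 - x / xc) powr (\<alpha> k - real k)"
        using near s_in[OF q]
      proof eventually_elim
        case (elim x)
        have y: "0 < 1 - x / xc" using elim xc(1) by simp
        have z: "0 < (1 - q) powr \<phi>" using q by simp
        let ?T = "(1 / (1 - q) powr \<phi>) powr (\<alpha> k - real k)" and ?Y = "(1 - x / xc) powr (\<alpha> k - real k)"
        have g: "?g q x = (1 - q) powr \<theta> * ?b q ^ k * (deriv ^^ k) \<F> (?s q x)"
          using elim by (intro iterated_deriv_x_scaling_form[OF smooth xc(1)]) auto
        have "?s q x ^ k / ?s q x powr \<alpha> k = 1 / ?s q x powr (\<alpha> k - real k)"
          using y z by (simp add: powr_diff powr_realpow)
        also have "?s q x powr (\<alpha> k - real k) = ?Y * ?T"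
          using y z by (simp add: powr_divide)
        finally have s: "?s q x ^ k / ?s q x powr \<alpha> k = 1 / (?Y * ?T)" .
        have "?s q x ^ k * (deriv ^^ k) \<F> (?s q x) / ?s q x powr \<alpha> k * ?T =
            (?s q x ^ k / ?s q x powr \<alpha> k) * ?T * (deriv ^^ k) \<F> (?s q x)"
          by simp
        also have "\<dots> = (deriv ^^ k) \<F> (?s q x) / ?Y"
          unfolding s using y z by simp
        finally show ?case unfolding g by simp
      qed
    qed
  qed
  \<comment> \<open>The product vanishes only if \<open>\<alpha> k\<close> equals some
    \<open>l < k\<close>, that is, an earlier exponent, which strict monotonicity excludes.\<close>
  have C: "C \<noteq> 0"
  proof -
    have "\<alpha> k \<noteq> real l" if l: "l < k" for l
      using prev[OF l] strict_monoD[OF \<alpha> l] by simp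
    then show ?thesis
      using h by (simp add: C_def)
  qed
  have M: "\<forall>\<^sub>F q in at_left 1. ?M q \<noteq> 0"
    using near1 by eventually_elim (use C xc(1) in auto)
  have cswap: "gf_converges (\<lambda>n m. c m n) q x" if "\<bar>q\<bar> < q1" "\<bar>x\<bar> < x1" for q x
    using c(3)[OF that(2,1)] by (simp add: gf_converges_swap[of c])
  have fswap: "gf_sing p c x q = gf (\<lambda>n m. real (p m n)) q x - gf (\<lambda>n m. c m n) q x" for x q
    by (simp add: gf_sing_def gf_swap[of c] gf_swap[of "\<lambda>m n. real (p m n)"])
  note core = sing_asymp_equiv_of_close_derivs[where a = "\<lambda>n m. real (p m n)" and k = k,
      OF zero_less_one xc(1) summable_on_x_deriv[OF growth xc(2,1)]
        conv_radius_x_deriv_coeff[OF growth xc(2,1)] x_deriv_coeff_eq_infsum[OF growth] c(2,1) cswap fswap close glim M \<tau>]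
  have "\<alpha> k - real k = 0" by (rule core(1))
  then show \<alpha>k: "\<alpha> k = real k" by simp
  have fact: "(\<Prod>l<k. real k - real l) = fact k"
    unfolding fact_prod_rev of_nat_prod atLeast0LessThan by (intro prod.cong) (auto simp: of_nat_diff)
  have "?M q / fact k = (1 / xc ^ k) * h k / (1 - q) powr (real k * \<phi> - \<theta>)" if "q < 1" for q
  proof -
    have "((1 - q) powr \<phi>) ^ k = (1 - q) powr (real k * \<phi>)"
      using that by (simp add: powr_power)
    then have b: "?b q ^ k = (- 1) ^ k / (xc ^ k * (1 - q) powr (real k * \<phi>))"
      by (simp only: power_divide power_mult_distrib)
    show ?thesis
      using that xc(1) unfolding C_def \<alpha>k fact b
      by (simp add: powr_diff divide_simps flip: power_mult_distrib)
  qed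
  \<comment> \<open>The simplification of the powers is available only for \<open>q < 1\<close>, so
    the right-hand sides are exchanged eventually rather than everywhere.\<close>
  then have "\<forall>\<^sub>F q in at_left 1. ?M q / fact k = (1 / xc ^ k) * h k / (1 - q) powr (real k * \<phi> - \<theta>)"
    using near1 by (auto elim: eventually_mono)
  from sing_asymp_equiv_cong[OF this] core(2)
  show "sing_asymp_equiv (x_deriv_coeff p xc k) 1 (\<lambda>q. (1 / xc ^ k) * h k / (1 - q) powr (real k * \<phi> - \<theta>))"
    by (rule iffD1)
qed

theorem lemma4:
  fixes p :: "nat \<Rightarrow> nat \<Rightarrow> nat" and c :: "nat \<Rightarrow> nat \<Rightarrow> real"
    and xc \<theta> \<phi> :: real and s\<^sub>m s\<^sub>p :: ereal and \<F> :: "real \<Rightarrow> real"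
  assumes growth: "polygon_growth p"
    and xc: "0 < xc" "xc \<le> 1" "conv_radius (\<lambda>m. real (row_sum p m)) = ereal xc"
    and phi: "\<phi> > 0"
    and interval: "s\<^sub>m < s\<^sub>p"
    and scaling: "has_scaling_function p c xc \<theta> \<phi> s\<^sub>m s\<^sub>p \<F>"
  shows "(\<forall>f \<gamma> :: nat \<Rightarrow> real.
      scaling_valid_q_derivs p c xc \<theta> \<phi> s\<^sub>m s\<^sub>p \<F> \<and> s\<^sub>p = \<infinity> \<and>
      smooth_between s\<^sub>m s\<^sub>p \<F> \<and> (\<forall>k. f k \<noteq> 0) \<and> strict_mono \<gamma> \<and>
      asymp_expansion_with_derivs at_top \<F> (\<lambda>k. (- 1) ^ k * f k) (\<lambda>k. - \<gamma> k)
      \<longrightarrow> (\<forall>k. \<gamma> k = (real k - \<theta>) / \<phi>) \<and>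
          (\<forall>k. sing_asymp_equiv (q_deriv_coeff p k) xc (\<lambda>x. f k / (1 - x / xc) powr \<gamma> k)))
    \<and> (\<forall>h \<alpha> :: nat \<Rightarrow> real.
      scaling_valid_x_derivs p c xc \<theta> \<phi> s\<^sub>m s\<^sub>p \<F> \<and> s\<^sub>m \<le> 0 \<and> 0 < s\<^sub>p \<and>
      smooth_between s\<^sub>m s\<^sub>p \<F> \<and> (\<forall>k. h k \<noteq> 0) \<and> strict_mono \<alpha> \<and>
      asymp_expansion_with_derivs (at_right 0) \<F> (\<lambda>k. (- 1) ^ k * h k) \<alpha>
      \<longrightarrow> (\<forall>k. \<alpha> k = real k) \<and>
          (\<forall>k. sing_asymp_equiv (x_deriv_coeff p xc k) 1
                 (\<lambda>q. (1 / xc ^ k) * h k / (1 - q) powr (real k * \<phi> - \<theta>))))"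
proof (intro conjI allI impI)
  obtain x1 q1 where c: "xc < x1" "1 < q1" "\<And>x q. \<bar>x\<bar> < x1 \<Longrightarrow> \<bar>q\<bar> < q1 \<Longrightarrow> gf_converges c x q"
    using scaling unfolding has_scaling_function_def by blast
  {
    fix f \<gamma> :: "nat \<Rightarrow> real" and k
    assume A: "scaling_valid_q_derivs p c xc \<theta> \<phi> s\<^sub>m s\<^sub>p \<F> \<and> s\<^sub>p = \<infinity> \<and>
      smooth_between s\<^sub>m s\<^sub>p \<F> \<and> (\<forall>k. f k \<noteq> 0) \<and> strict_mono \<gamma> \<and>
      asymp_expansion_with_derivs at_top \<F> (\<lambda>k. (- 1) ^ k * f k) (\<lambda>k. - \<gamma> k)"
    note step = q_derivative_step[where f = f and \<gamma> = \<gamma>, OF growth xc(1,3) phi _ c]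
    \<comment> \<open>Strong induction is used because the step for \<open>k\<close> needs all
      smaller exponents. Once all exponents are known, the asymptotic statements follow for each
      \<open>k\<close> separately.\<close>
    have e: "\<theta> + \<phi> * \<gamma> k = real k" for k
    proof (induction k rule: less_induct)
      case (less k)
      show ?case by (rule step(1)) (use A interval less in auto)
    qed
    show "\<gamma> k = (real k - \<theta>) / \<phi>"
      using e[of k] phi by (simp add: field_simps)
    show "sing_asymp_equiv (q_deriv_coeff p k) xc (\<lambda>x. f k / (1 - x / xc) powr \<gamma> k)"
      by (rule step(2)) (use A interval e in auto)
  next
    fix h \<alpha> :: "nat \<Rightarrow> real" and k
    assume A: "scaling_valid_x_derivs p c xc \<theta> \<phi> s\<^sub>m s\<^sub>p \<F> \<and> s\<^sub>m \<le> 0 \<and> 0 < s\<^sub>p \<and>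
      smooth_between s\<^sub>m s\<^sub>p \<F> \<and> (\<forall>k. h k \<noteq> 0) \<and> strict_mono \<alpha> \<and>
      asymp_expansion_with_derivs (at_right 0) \<F> (\<lambda>k. (- 1) ^ k * h k) \<alpha>"
    note step = x_derivative_step[where h = h and \<alpha> = \<alpha>, OF growth xc(1,3) _ _ c]
    show e: "\<alpha> k = real k" for k
    proof (induction k rule: less_induct)
      case (less k)
      show ?case by (rule step(1)) (use A less in auto)
    qed
    show "sing_asymp_equiv (x_deriv_coeff p xc k) 1
        (\<lambda>q. (1 / xc ^ k) * h k / (1 - q) powr (real k * \<phi> - \<theta>))"
      by (rule step(2)) (use A e in auto)
  }
qed

end
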